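(* Let $\ell\in\frac12\mathbb{N}$, $\ell>0$, and let $D$ be the second order matrix-valued differential operator $$D=(x^2-1)\frac{d^2}{dx^2}+\left(\frac{d}{dx}\right)B_1(x)+B_0,$$ where $$B_1(x)=\sum_{i=0}^{2\ell}\frac{(4\ell+3)(i-2\ell)}{2\ell}E_{i,i+1}-\sum_{i=0}^{2\ell}x\,\frac{(2\ell+3)(i-2\ell)}{\ell}E_{i,i}+\sum_{i=0}^{2\ell}\frac{3i}{2\ell}E_{i,i-1},$$ $$B_0=\sum_{i=0}^{2\ell}\frac{(i-2\ell)(i\ell-2\ell^2-5\ell-3)}{2\ell}E_{i,i}.$$ Then $D$ is symmetric with respect to the weight $W$ defined in the context; hence $D\in\mathcal D(W)$. Moreover, for every integer $n\ge0$, $$P_n(x)D=\Lambda_n(D)P_n(x),$$ where $$\Lambda_n(D)=\sum_{i=0}^{2\ell}\left(n(n-1)-\frac{n(2\ell+3)(i-2\ell)}{\ell}+\frac{(i-2\ell)(i\ell-2\ell^2-5\ell-3)}{2\ell}\right)E_{i,i}$$ and $\{P_n\}_{n\ge0}$ is the sequence of monic orthogonal polynomials with respect to $W$.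
   Context: All matrices are $(2\ell+1)\times(2\ell+1)$ with rows and columns indexed by $\{0,\dots,2\ell\}$; $E_{i,j}$ is the elementary matrix, interpreted as $0$ when an index is out of range. $(a)_k=a(a+1)\cdots(a+k-1)$, $(a)_0=1$; $U_k$ is the Chebyshev polynomial of the second kind of degree $k$. The weight on $(-1,1)$ is, for $m\le n$, $$W(x)_{n,m}=(1-x^2)^{\frac12}\,\frac{2\ell+1}{n+1}\,\frac{(2\ell-m)!\,m!}{(2\ell)!}\sum_{t=0}^m(-1)^{m-t}\frac{(n-2\ell)_{m-t}}{(n+2)_{m-t}}\frac{(2\ell+2-t)_t}{t!}\,U_{n+m-2t}(x),$$ and $W(x)_{n,m}=W(x)_{m,n}$ if $n<m$. Put $\langle P,Q\rangle=\int_{-1}^1P(x)W(x)Q(x)^*dx$ for matrix polynomials $P,Q$. $\{P_n\}$ are the unique monic matrix polynomials ($\deg P_n=n$) with $\langle P_n,P_m\rangle=0$ for $n\neq m$. Differential operators $D=\sum_i\partial^iF_i(x)$, $\partial=\frac{d}{dx}$, with matrix polynomial coefficients, $\deg F_i\le i$, act from the right: $PD=\sum_i\partial^i(P)(x)F_i(x)$. $D$ is symmetric with respect to $W$ if $\langle PD,Q\rangle=\langle P,QD\rangle$ for all matrix polynomials $P,Q$. $\mathcal D(W)$ is the algebra of such operators $D$ for which there are constant matrices $\Gamma_n(D)$ with $P_nD=\Gamma_n(D)P_n$ for all $n\ge0$.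
   Formalization: The printed denominator 2ℓ in the entries of B_0 and in the last summand of Λ_n(D) is replaced by ℓ in both places; as printed the claim is false (for ℓ=1/2 the (1,0) entry of P_1D is 3/2, that of Λ_1P_1 is 0). *)

theory Defs
  imports
    "HOL-Analysis.Analysis"
    "HOL-Computational_Algebra.Polynomial"
    "Jordan_Normal_Form.Matrix"
    "Jordan_Normal_Form.Schur_Decomposition"
begin

text \<open>
  Throughout, \<open>N\<close> stands for \<open>2\<ell>\<close>, so that \<open>\<ell>\<close> runs through the half-integers; matrices have
  size \<open>N + 1\<close> and indices \<open>0, \<dots>, N\<close>.  A matrix polynomial is a square matrix whose
  entries are complex polynomials.
\<close>

abbreviation ell :: "nat \<Rightarrow> real" where
  "ell N \<equiv> real N / 2"

section \<open>The weight\<close>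

fun chebyshev_U :: "nat \<Rightarrow> real \<Rightarrow> real" where
  "chebyshev_U 0 x = 1"
| "chebyshev_U (Suc 0) x = 2 * x"
| "chebyshev_U (Suc (Suc k)) x = 2 * x * chebyshev_U (Suc k) x - chebyshev_U k x"

text \<open>The formula for the \<open>(n, m)\<close> entry, valid for \<open>m \<le> n \<le> N\<close>.\<close>

definition weight_entry :: "nat \<Rightarrow> real \<Rightarrow> nat \<Rightarrow> nat \<Rightarrow> real" where
  "weight_entry N x n m =
     sqrt (1 - x\<^sup>2) * ((real N + 1) / (real n + 1)) * (fact (N - m) * fact m / fact N) *
     (\<Sum>t=0..m. (-1) ^ (m - t) *
        (pochhammer (real n - real N) (m - t) / pochhammer (real n + 2) (m - t)) *
        (pochhammer (real N + 2 - real t) t / fact t) *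
        chebyshev_U (n + m - 2 * t) x)"

definition weight :: "nat \<Rightarrow> real \<Rightarrow> complex mat" where
  "weight N x = mat (N + 1) (N + 1) (\<lambda>(i, j).
     complex_of_real (if j \<le> i then weight_entry N x i j else weight_entry N x j i))"

section \<open>Matrix polynomials and monic orthogonal polynomials\<close>

definition eval_mat :: "complex poly mat \<Rightarrow> real \<Rightarrow> complex mat" where
  "eval_mat P x = map_mat (\<lambda>p. poly p (complex_of_real x)) P"

definition const_mat :: "complex mat \<Rightarrow> complex poly mat" where
  "const_mat A = map_mat (\<lambda>c. [:c:]) A"

definition degree_le :: "nat \<Rightarrow> complex poly mat \<Rightarrow> bool" where
  "degree_le n P \<longleftrightarrow> (\<forall>i < dim_row P. \<forall>j < dim_col P. degree (P $$ (i, j)) \<le> n)"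

definition matrix_inner ::
  "nat \<Rightarrow> (real \<Rightarrow> complex mat) \<Rightarrow> complex poly mat \<Rightarrow> complex poly mat \<Rightarrow> complex mat" where
  "matrix_inner d W P Q = mat d d (\<lambda>(i, j).
     integral {-1..1} (\<lambda>x. (eval_mat P x * W x * mat_adjoint (eval_mat Q x)) $$ (i, j)))"

definition monic_of_degree :: "nat \<Rightarrow> nat \<Rightarrow> complex poly mat \<Rightarrow> bool" where
  "monic_of_degree d n P \<longleftrightarrow>
     P \<in> carrier_mat d d \<and> degree_le n P \<and> map_mat (\<lambda>p. coeff p n) P = 1\<^sub>m d"

definition is_monic_OPS ::
  "nat \<Rightarrow> (real \<Rightarrow> complex mat) \<Rightarrow> (nat \<Rightarrow> complex poly mat) \<Rightarrow> bool" where
  "is_monic_OPS d W P \<longleftrightarrow>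
     (\<forall>n. monic_of_degree d n (P n)) \<and>
     (\<forall>n m. n \<noteq> m \<longrightarrow> matrix_inner d W (P n) (P m) = 0\<^sub>m d d)"

definition monic_OPS :: "nat \<Rightarrow> (real \<Rightarrow> complex mat) \<Rightarrow> nat \<Rightarrow> complex poly mat" where
  "monic_OPS d W = (THE P. is_monic_OPS d W P)"

section \<open>Differential operators acting from the right\<close>

text \<open>The operator \<open>\<Sum>i. \<partial>\<^sup>i F\<^sub>i(x)\<close> is represented by the list of its coefficients
  \<open>[F\<^sub>0, F\<^sub>1, \<dots>]\<close>.\<close>

type_synonym diffop = "complex poly mat list"

definition is_diffop :: "nat \<Rightarrow> diffop \<Rightarrow> bool" where
  "is_diffop d D \<longleftrightarrow> (\<forall>i < length D. D ! i \<in> carrier_mat d d \<and> degree_le i (D ! i))"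

definition diffop_act :: "nat \<Rightarrow> complex poly mat \<Rightarrow> diffop \<Rightarrow> complex poly mat" where
  "diffop_act d P D = mat d d (\<lambda>(r, c).
     \<Sum>i < length D. (map_mat (pderiv ^^ i) P * D ! i) $$ (r, c))"

definition symmetric_diffop :: "nat \<Rightarrow> (real \<Rightarrow> complex mat) \<Rightarrow> diffop \<Rightarrow> bool" where
  "symmetric_diffop d W D \<longleftrightarrow>
     (\<forall>P \<in> carrier_mat d d. \<forall>Q \<in> carrier_mat d d.
        matrix_inner d W (diffop_act d P D) Q = matrix_inner d W P (diffop_act d Q D))"

definition diffop_algebra :: "nat \<Rightarrow> (real \<Rightarrow> complex mat) \<Rightarrow> diffop set" where
  "diffop_algebra d W = {D. is_diffop d D \<and>
     (\<exists>\<Gamma>. \<forall>n. \<Gamma> n \<in> carrier_mat d d \<and>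
        diffop_act d (monic_OPS d W n) D = const_mat (\<Gamma> n) * monic_OPS d W n)}"

section \<open>The second order operator and its eigenvalues\<close>

definition coeff_B1 :: "nat \<Rightarrow> complex poly mat" where
  "coeff_B1 N = mat (N + 1) (N + 1) (\<lambda>(i, j).
     if j = i + 1 then [: complex_of_real ((4 * ell N + 3) * (real i - 2 * ell N) / (2 * ell N)) :]
     else if j = i then
       - [: 0, complex_of_real ((2 * ell N + 3) * (real i - 2 * ell N) / ell N) :]
     else if i = j + 1 then [: complex_of_real (3 * real i / (2 * ell N)) :]
     else 0)"

text \<open>
  Correction: the source prints the entries of \<open>B\<^sub>0\<close> (and the corresponding last summand of the
  eigenvalue) with denominator \<open>2\<ell>\<close>.  With that factor the operator is not symmetric.  For
  \<open>\<ell> = 1/2\<close>, where \<open>W(x) = 2 \<surd>(1 - x\<^sup>2) [[1, x], [x, 1]]\<close> and \<open>P\<^sub>1(x) = [[x, -1/4], [-1/4, x]]\<close>,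
  the \<open>(1, 0)\<close> entry of \<open>P\<^sub>1 D\<close> would be \<open>3 - 6/4\<close>, whereas that of \<open>\<Lambda>\<^sub>1 P\<^sub>1\<close> is \<open>0\<close>; with
  denominator \<open>\<ell>\<close> it is \<open>3 - 12/4 = 0\<close>.
\<close>

definition B0_entry :: "nat \<Rightarrow> nat \<Rightarrow> real" where
  "B0_entry N i =
     (real i - 2 * ell N) * (real i * ell N - 2 * (ell N)\<^sup>2 - 5 * ell N - 3) / ell N"

definition coeff_B0 :: "nat \<Rightarrow> complex poly mat" where
  "coeff_B0 N = const_mat (mat_diag (N + 1) (\<lambda>i. complex_of_real (B0_entry N i)))"

definition op_D :: "nat \<Rightarrow> diffop" where
  "op_D N = [coeff_B0 N, coeff_B1 N, mat_diag (N + 1) (\<lambda>_. [: -1, 0, 1 :])]"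

definition Lambda :: "nat \<Rightarrow> nat \<Rightarrow> complex mat" where
  "Lambda N n = mat_diag (N + 1) (\<lambda>i. complex_of_real
     (real n * (real n - 1) - real n * (2 * ell N + 3) * (real i - 2 * ell N) / ell N
      + B0_entry N i))"

end

theory Submission
  imports Defs
begin

text \<open>
  Write \<open>x = cos \<theta>\<close>, \<open>z = exp (i \<theta>)\<close> and \<open>f\<^sub>a = (N + 1 choose a)\<close>.  The proof rests on the fact that
  the Pochhammer quotients in the weight are disguised binomial coefficients
  (\<open>weight_entry_eq_weight_trig\<close>):
  \<open>(N choose n) (N choose m) W\<^sub>n\<^sub>m = \<Sum>\<^sub>a\<^sub>\<le>\<^sub>m f\<^sub>a f\<^sub>b sin ((b - a) \<theta>)\<close>, where \<open>b = n + m + 1 - a\<close>.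
  The formula is valid without the restriction \<open>m \<le> n\<close>, as its summands are antisymmetric in
  \<open>a\<close> and \<open>b\<close>.

  Positivity.  The generating function of the right-hand sides is
  \<open>sin \<theta> (p\<^sup>N\<^sup>+\<^sup>1 - q\<^sup>N\<^sup>+\<^sup>1) / (p - q) = sin \<theta> \<Sum>\<^sub>j p\<^sup>j q\<^sup>N\<^sup>-\<^sup>j\<close> with \<open>p = (1 + u z) (1 + v / z)\<close> and
  \<open>q = (1 + u / z) (1 + v z)\<close>.  For each \<open>j\<close>, the summand is a polynomial in \<open>u\<close> times the conjugate
  of the same polynomial in \<open>v\<close>.  Hence the weight is \<open>sin \<theta>\<close> times a Gram matrix, and it is positive
  definite because the polynomials in \<open>u\<close> form a basis when \<open>z\<close> is not real (\<open>sine_sum_positive\<close>).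
  By Gram-Schmidt the monic orthogonal polynomials exist and are unique.

  Symmetry.  Integration by parts reduces it to two differential equations,
  \<open>((x\<^sup>2 - 1) W)' = (B\<^sub>1 W + W B\<^sub>1\<^sup>T) / 2\<close> and \<open>((B\<^sub>1 W - W B\<^sub>1\<^sup>T) / 2)' = B\<^sub>0 W - W B\<^sub>0\<close>, there being
  no boundary terms since \<open>W\<close> vanishes at \<open>1\<close> and \<open>-1\<close> (\<open>second_order_symmetric\<close>).  Entry by entry
  these equations compare trigonometric sums of the form above for neighbouring indices, and they follow
  from four telescoping identities (\<open>sine_sum_identities\<close>).

  Eigenvalues.  \<open>D\<close> does not raise degrees and acts on coefficients of top degree by the diagonal matrix
  \<open>\<Lambda>\<^sub>n\<close> (\<open>coeff_D_row\<close>).  So \<open>P\<^sub>n D - \<Lambda>\<^sub>n P\<^sub>n\<close> has degree less than \<open>n\<close>; by symmetry it is orthogonal to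
  all polynomials of degree less than \<open>n\<close>, and by positivity it is zero
  (\<open>eigenrow_of_symmetric_operator\<close>).
\<close>

section \<open>Sums of sines weighted by products of binomial coefficients\<close>

text \<open>
  The upper index is \<open>N + 1\<close> because the generating function of the weight is a quotient whose numerator
  is a difference of \<open>(N + 1)\<close>-st powers, see \<open>gram_telescope\<close> below.\<close>

definition binom_coeff :: "nat \<Rightarrow> nat \<Rightarrow> real" where
  "binom_coeff N a = real (Suc N choose a)"

lemma binom_coeff_Suc: "(real a + 1) * binom_coeff N (Suc a) = (real N + 1 - real a) * binom_coeff N a"
proof (cases "a \<le> Suc N")
  case True
  have "Suc a * (Suc N choose Suc a) = (Suc N - a) * (Suc N choose a)"
    using binomial_absorb_comp[of "Suc N" a] binomial_absorption[of a "Suc N"]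
    by (metis Suc_times_binomial_eq diff_Suc_1 mult.commute)
  then have "real (Suc a) * real (Suc N choose Suc a) = real (Suc N - a) * real (Suc N choose a)"
    by (metis of_nat_mult)
  then show ?thesis using True by (simp add: binom_coeff_def of_nat_diff algebra_simps)
next
  case False
  then show ?thesis by (simp add: binom_coeff_def binomial_eq_0)
qed

text \<open>
  With \<open>f\<^sub>a\<close> for the binomial coefficients above, this is the partial sum of
  \<open>f\<^sub>a f\<^sub>b sin ((b - a) \<theta>)\<close> over \<open>a + b = s\<close> with \<open>a < M\<close>.  The two parameters are independent so that
  entries of the weight with neighbouring indices can be compared for one and the same \<open>M\<close>.\<close>

definition sine_sum :: "nat \<Rightarrow> nat \<Rightarrow> nat \<Rightarrow> real \<Rightarrow> real" where
  "sine_sum N s M \<theta> = (\<Sum>a<M. binom_coeff N a * binom_coeff N (s - a) * sin ((real s - 2 * real a) * \<theta>))"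

definition sine_sum_deriv :: "nat \<Rightarrow> nat \<Rightarrow> nat \<Rightarrow> real \<Rightarrow> real" where
  "sine_sum_deriv N s M \<theta> = (\<Sum>a<M. binom_coeff N a * binom_coeff N (s - a) *
     ((real s - 2 * real a) * cos ((real s - 2 * real a) * \<theta>)))"

lemma has_deriv_sine_sum:
  "(sine_sum N s M has_real_derivative sine_sum_deriv N s M \<theta>) (at \<theta>)"
  unfolding sine_sum_def[abs_def] sine_sum_deriv_def
  by (auto intro!: derivative_eq_intros sum.cong)

text \<open>
  The summand changes sign under \<open>a \<mapsto> s - a\<close>, so the terms with \<open>M \<le> a < M'\<close> cancel in pairs.  This
  one fact gives the symmetry of the weight and also the vanishing of the sum that stands for an entry
  with row index \<open>-1\<close>.\<close>

lemma sine_sum_reflect: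
  assumes "M + M' = Suc s"
  shows "sine_sum N s M \<theta> = sine_sum N s M' \<theta>"
proof -
  have *: "sine_sum N s m \<theta> = sine_sum N s m' \<theta>" if "m + m' = Suc s" "m \<le> m'" for m m'
  proof -
    let ?g = "\<lambda>a. binom_coeff N a * binom_coeff N (s - a) * sin ((real s - 2 * real a) * \<theta>)"
    have "sum ?g {m..<m'} = sum (\<lambda>a. - ?g a) {m..<m'}"
    proof (rule sum.reindex_bij_witness[of _ "\<lambda>a. s - a" "\<lambda>a. s - a"])
      fix a assume a: "a \<in> {m..<m'}"
      then have le: "a \<le> s" using that by auto
      have "(real s - 2 * real (s - a)) * \<theta> = - ((real s - 2 * real a) * \<theta>)"
        using le by (simp add: of_nat_diff algebra_simps)
      then have "sin ((real s - 2 * real (s - a)) * \<theta>) = - sin ((real s - 2 * real a) * \<theta>)"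
        by (simp only: sin_minus)
      then show "- ?g (s - a) = ?g a"
        using le by simp
    qed (use that in auto)
    then have "sum ?g {m..<m'} = 0" by (simp add: sum_negf)
    moreover have "sum ?g {..<m'} = sum ?g {..<m} + sum ?g {m..<m'}"
      using that(2) by (metis (no_types, lifting) atLeast0LessThan sum.atLeastLessThan_concat zero_le)
    ultimately show ?thesis by (simp add: sine_sum_def)
  qed
  show ?thesis using *[of M M'] *[of M' M] assms by (metis add.commute nat_le_linear)
qed

lemma sin_cos_shift:
  fixes k \<theta> :: real
  shows "sin ((k + 1) * \<theta>) = sin (k * \<theta>) * cos \<theta> + cos (k * \<theta>) * sin \<theta>"
    "sin ((k - 1) * \<theta>) = sin (k * \<theta>) * cos \<theta> - cos (k * \<theta>) * sin \<theta>"
    "cos ((k + 1) * \<theta>) = cos (k * \<theta>) * cos \<theta> - sin (k * \<theta>) * sin \<theta>"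
    "cos ((k - 1) * \<theta>) = cos (k * \<theta>) * cos \<theta> + sin (k * \<theta>) * sin \<theta>"
  by (simp_all add: distrib_right left_diff_distrib sin_add sin_diff cos_add cos_diff)

lemma sine_sum_new_terms:
  assumes "t = n + M" "k = real n + 1 - real M"
  shows "sine_sum N t (Suc M) \<theta> = sine_sum N t M \<theta>
      + binom_coeff N M * binom_coeff N n * sin ((k - 1) * \<theta>)"
    "sine_sum N (t + 1) (Suc M) \<theta> = sine_sum N (t + 1) M \<theta>
      + binom_coeff N M * binom_coeff N (Suc n) * sin (k * \<theta>)"
    "sine_sum N (t + 2) (Suc M) \<theta> = sine_sum N (t + 2) M \<theta>
      + binom_coeff N M * binom_coeff N (Suc (Suc n)) * sin ((k + 1) * \<theta>)"
    "sine_sum_deriv N t (Suc M) \<theta> = sine_sum_deriv N t M \<theta>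
      + binom_coeff N M * binom_coeff N n * ((k - 1) * cos ((k - 1) * \<theta>))"
    "sine_sum_deriv N (t + 1) (Suc M) \<theta> = sine_sum_deriv N (t + 1) M \<theta>
      + binom_coeff N M * binom_coeff N (Suc n) * (k * cos (k * \<theta>))"
    "sine_sum_deriv N (t + 2) (Suc M) \<theta> = sine_sum_deriv N (t + 2) M \<theta>
      + binom_coeff N M * binom_coeff N (Suc (Suc n)) * ((k + 1) * cos ((k + 1) * \<theta>))"
proof -
  have "real t - 2 * real M = k - 1" "real (t + 1) - 2 * real M = k"
    "real (t + 2) - 2 * real M = k + 1" "t - M = n" "t + 1 - M = Suc n" "t + 2 - M = Suc (Suc n)"
    using assms by auto
  then show "sine_sum N t (Suc M) \<theta> = sine_sum N t M \<theta>
      + binom_coeff N M * binom_coeff N n * sin ((k - 1) * \<theta>)"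
    "sine_sum N (t + 1) (Suc M) \<theta> = sine_sum N (t + 1) M \<theta>
      + binom_coeff N M * binom_coeff N (Suc n) * sin (k * \<theta>)"
    "sine_sum N (t + 2) (Suc M) \<theta> = sine_sum N (t + 2) M \<theta>
      + binom_coeff N M * binom_coeff N (Suc (Suc n)) * sin ((k + 1) * \<theta>)"
    "sine_sum_deriv N t (Suc M) \<theta> = sine_sum_deriv N t M \<theta>
      + binom_coeff N M * binom_coeff N n * ((k - 1) * cos ((k - 1) * \<theta>))"
    "sine_sum_deriv N (t + 1) (Suc M) \<theta> = sine_sum_deriv N (t + 1) M \<theta>
      + binom_coeff N M * binom_coeff N (Suc n) * (k * cos (k * \<theta>))"
    "sine_sum_deriv N (t + 2) (Suc M) \<theta> = sine_sum_deriv N (t + 2) M \<theta>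
      + binom_coeff N M * binom_coeff N (Suc (Suc n)) * ((k + 1) * cos ((k + 1) * \<theta>))"
    by (simp_all only: sine_sum_def sine_sum_deriv_def sum.lessThan_Suc)
qed

text \<open>
  Four relations between three consecutive values of \<open>s\<close>.  Each one holds termwise up to a telescoping
  remainder, and the remainder is the right-hand side.  Where they come from: read the index \<open>n\<close> as the
  exponent of a variable.  The first says that a first order operator (the element of \<open>sl\<^sub>2\<close> that
  has \<open>1 + u z\<close> and \<open>1 + u / z\<close> as eigenvectors), acting on both indices, annihilates the weight; the
  second is a first order differential equation in \<open>\<theta>\<close>; the last two, multiplied by \<open>n - m\<close> for
  \<open>M = m + 1\<close>, are the parts of the second symmetry equation that are invariant and anti-invariant under
  reversal of the indices, the latter modulo the derivative of the first relation.\<close>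

lemma sine_sum_identities:
  assumes "n + M = Suc t"
  shows "(2 * real N - real t + 2) * sine_sum N t M \<theta> - (real t + 2) * sine_sum N (t + 2) M \<theta>
     - 2 * cos \<theta> * (real t - real N) * sine_sum N (t + 1) M \<theta>
   = real M * binom_coeff N M * (binom_coeff N (Suc n) + binom_coeff N n) * sin ((real n + 1 - real M) * \<theta>)"
  (is ?R1)
  "2 * sin \<theta> * sine_sum_deriv N (t + 1) M \<theta> - 2 * cos \<theta> * (real N + 1) * sine_sum N (t + 1) M \<theta>
     + (real t + 2) * sine_sum N (t + 2) M \<theta> + (2 * real N - real t + 2) * sine_sum N t M \<theta>
   = - real M * binom_coeff N M * (binom_coeff N (Suc n) - binom_coeff N n) * sin ((real n + 1 - real M) * \<theta>)"
  (is ?R2)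
  "sine_sum_deriv N (t + 2) M \<theta> - sine_sum_deriv N t M \<theta>
     - 2 * sin \<theta> * (real t - real N) * sine_sum N (t + 1) M \<theta>
   = real M * binom_coeff N M * (binom_coeff N (Suc n) - binom_coeff N n) * cos ((real n + 1 - real M) * \<theta>)"
  (is ?E1)
  "sine_sum_deriv N (t + 2) M \<theta> + sine_sum_deriv N t M \<theta>
     + 2 * cos \<theta> * sine_sum_deriv N (t + 1) M \<theta>
     + 2 * sin \<theta> * (real N + 1) * sine_sum N (t + 1) M \<theta>
   = real M * binom_coeff N M * (binom_coeff N (Suc n) + binom_coeff N n) * cos ((real n + 1 - real M) * \<theta>)"
  (is ?E2)
proof -
  have "?R1 \<and> ?R2 \<and> ?E1 \<and> ?E2"
    using assms
  proof (induction M arbitrary: n)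
    case 0
    then show ?case by (simp add: sine_sum_def sine_sum_deriv_def)
  next
    case (Suc M)
    define k where "k = real n + 1 - real M"
    have tn: "t = n + M" using Suc.prems by simp
    have n: "real n = k - 1 + real M" and t: "real t = k - 1 + 2 * real M" using tn by (auto simp: k_def)
    have e: "real n + 1 - real (Suc M) = k - 1" "real (Suc n) + 1 - real M = k + 1"
      by (auto simp: k_def)
    note f = binom_coeff_Suc[of n N] binom_coeff_Suc[of "Suc n" N] binom_coeff_Suc[of M N]
    have "Suc n + M = Suc t" using Suc.prems by auto
    note IH = Suc.IH[OF this, THEN conjunct1] Suc.IH[OF this, THEN conjunct2, THEN conjunct1]
      Suc.IH[OF this, THEN conjunct2, THEN conjunct2, THEN conjunct1]
      Suc.IH[OF this, THEN conjunct2, THEN conjunct2, THEN conjunct2]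
    note nt = sine_sum_new_terms[OF tn k_def, of N \<theta>]
    define F f0 f1 f2 F' where "F = binom_coeff N M" and "f0 = binom_coeff N n"
      and "f1 = binom_coeff N (Suc n)" and "f2 = binom_coeff N (Suc (Suc n))"
      and "F' = binom_coeff N (Suc M)"
    note F_defs = F_def[symmetric] F'_def[symmetric] f0_def[symmetric] f1_def[symmetric] f2_def[symmetric]
    define s c x S where "s = sin (k * \<theta>)" and "c = cos (k * \<theta>)"
      and "x = cos \<theta>" and "S = sin \<theta>"
    note s_defs = s_def[symmetric] c_def[symmetric] x_def[symmetric] S_def[symmetric]
    \<comment> \<open>The summand added in passing from \<open>M\<close> to \<open>M + 1\<close> and the two remainders agree up to multiples
      of these three contiguity relations; the multiples are found by sorting according to the
      frequencies \<open>k + 1\<close> and \<open>k - 1\<close>.\<close>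
    have d: "(k + real M) * f1 - (real N + 2 - k - real M) * f0 = 0"
      "(k + 1 + real M) * f2 - (real N + 1 - k - real M) * f1 = 0"
      "(real M + 1) * F' - (real N + 1 - real M) * F = 0"
      using f unfolding F_defs of_nat_Suc n by (simp_all add: algebra_simps)
    show ?case
      unfolding nt e unfolding sin_cos_shift of_nat_Suc t n F_defs s_defs
    proof (intro conjI, goal_cases)
      case 1
      show ?case (is "?l = ?r")
      proof -
        note ih = IH(1)[unfolded e, unfolded sin_cos_shift t F_defs s_defs]
        have "?l - ?r = (((2 * real N - (k - 1 + 2 * real M) + 2) * sine_sum N t M \<theta> - ((k - 1 + 2 * real M) + 2) * sine_sum N (t + 2) M \<theta> - 2 * x * ((k - 1 + 2 * real M) - real N) * sine_sum N (t + 1) M \<theta>) - real M * F * (f2 + f1) * (s * x + c * S)) - ((real M + 1) * F' - (real N + 1 - real M) * F) * (f1 + f0) * (s * x - c * S)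
           - F * (s * x + c * S) * ((k + 1 + real M) * f2 - (real N + 1 - k - real M) * f1) - F * (s * x - c * S) * ((k + real M) * f1 - (real N + 2 - k - real M) * f0)"
          by (simp add: algebra_simps)
        then show ?thesis unfolding d ih by simp
      qed
    next
      case 2
      show ?case (is "?l = ?r")
      proof -
        note ih = IH(2)[unfolded e, unfolded sin_cos_shift t F_defs s_defs]
        have "?l - ?r = ((2 * S * sine_sum_deriv N (t + 1) M \<theta> - 2 * x * (real N + 1) * sine_sum N (t + 1) M \<theta> + ((k - 1 + 2 * real M) + 2) * sine_sum N (t + 2) M \<theta> + (2 * real N - (k - 1 + 2 * real M) + 2) * sine_sum N t M \<theta>) - - real M * F * (f2 - f1) * (s * x + c * S)) + ((real M + 1) * F' - (real N + 1 - real M) * F) * (f1 - f0) * (s * x - c * S)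
           + F * (s * x + c * S) * ((k + 1 + real M) * f2 - (real N + 1 - k - real M) * f1) - F * (s * x - c * S) * ((k + real M) * f1 - (real N + 2 - k - real M) * f0)"
          by (simp add: algebra_simps)
        then show ?thesis unfolding d ih by simp
      qed
    next
      case 3
      show ?case (is "?l = ?r")
      proof -
        note ih = IH(3)[unfolded e, unfolded sin_cos_shift t F_defs s_defs]
        have "?l - ?r = ((sine_sum_deriv N (t + 2) M \<theta> - sine_sum_deriv N t M \<theta> - 2 * S * ((k - 1 + 2 * real M) - real N) * sine_sum N (t + 1) M \<theta>) - real M * F * (f2 - f1) * (c * x - s * S)) - ((real M + 1) * F' - (real N + 1 - real M) * F) * (f1 - f0) * (c * x + s * S)
           + F * (c * x - s * S) * ((k + 1 + real M) * f2 - (real N + 1 - k - real M) * f1) - F * (c * x + s * S) * ((k + real M) * f1 - (real N + 2 - k - real M) * f0)"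
          by (simp add: algebra_simps)
        then show ?thesis unfolding d ih by simp
      qed
    next
      case 4
      show ?case (is "?l = ?r")
      proof -
        note ih = IH(4)[unfolded e, unfolded sin_cos_shift t F_defs s_defs]
        have "?l - ?r = ((sine_sum_deriv N (t + 2) M \<theta> + sine_sum_deriv N t M \<theta> + 2 * x * sine_sum_deriv N (t + 1) M \<theta> + 2 * S * (real N + 1) * sine_sum N (t + 1) M \<theta>) - real M * F * (f2 + f1) * (c * x - s * S)) - ((real M + 1) * F' - (real N + 1 - real M) * F) * (f1 + f0) * (c * x + s * S)
           + F * (c * x - s * S) * ((k + 1 + real M) * f2 - (real N + 1 - k - real M) * f1) + F * (c * x + s * S) * ((k + real M) * f1 - (real N + 2 - k - real M) * f0)"
          by (simp add: algebra_simps)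
        then show ?thesis unfolding d ih by simp
      qed
    qed
  qed
  then show ?R1 ?R2 ?E1 ?E2 by blast+
qed

lemma sin_mult_chebyshev_U: "sin \<theta> * chebyshev_U k (cos \<theta>) = sin ((real k + 1) * \<theta>)"
proof (induction k "cos \<theta>" rule: chebyshev_U.induct)
  case 2
  then show ?case by (simp add: sin_double)
next
  case (3 k)
  have "sin ((real (Suc (Suc k)) + 1) * \<theta>) + sin ((real k + 1) * \<theta>)
      = 2 * cos \<theta> * sin ((real (Suc k) + 1) * \<theta>)"
    using sin_cos_shift(1,2)[of "real (Suc k) + 1" \<theta>] by (simp add: algebra_simps)
  moreover have "sin \<theta> * chebyshev_U (Suc (Suc k)) (cos \<theta>)
      = 2 * cos \<theta> * (sin \<theta> * chebyshev_U (Suc k) (cos \<theta>)) - sin \<theta> * chebyshev_U k (cos \<theta>)"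
    by (simp add: algebra_simps)
  ultimately show ?case unfolding 3 by linarith
qed simp

section \<open>The weight in trigonometric form\<close>

definition weight_trig :: "nat \<Rightarrow> nat \<Rightarrow> nat \<Rightarrow> real \<Rightarrow> real" where
  "weight_trig N n m \<theta> =
     sine_sum N (n + m + 1) (m + 1) \<theta> / (real (N choose n) * real (N choose m))"

lemma weight_trig_sym: "weight_trig N n m \<theta> = weight_trig N m n \<theta>"
  using sine_sum_reflect[of "m + 1" "n + 1" "n + m + 1" N \<theta>]
  by (simp add: weight_trig_def add.commute mult.commute)

text \<open>
  Both sides are hypergeometric in \<open>k\<close> with the same term ratio; for \<open>k > N - n\<close> both vanish.\<close>

lemma pochhammer_ratio_binom_coeff:
  assumes "n \<le> N"
  shows "(real N + 1) / (real n + 1) * ((-1) ^ k * (pochhammer (real n - real N) k / pochhammer (real n + 2) k))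
    = binom_coeff N (n + 1 + k) / real (N choose n)"
proof (induction k)
  case 0
  have "(real n + 1) * real (Suc N choose Suc n) = (real N + 1) * real (N choose n)"
    using Suc_times_binomial_eq[of N n] by (metis mult.commute of_nat_Suc of_nat_mult add.commute)
  moreover have "real (N choose n) > 0" using assms by simp
  ultimately show ?case by (simp add: binom_coeff_def field_simps del: binomial_Suc_Suc)
next
  case (Suc k)
  have "(real (n + 1 + k) + 1) * binom_coeff N (n + 1 + Suc k)
      = (real N - real n - real k) * binom_coeff N (n + 1 + k)"
    using binom_coeff_Suc[of "n + 1 + k" N] by simp
  then have s: "binom_coeff N (n + 1 + Suc k)
      = binom_coeff N (n + 1 + k) * (- (real n - real N + real k) / (real n + 2 + real k))"
    by (simp add: field_simps)
  have regroup: "a * ((-1) ^ Suc k * ((p * x) / (q * y))) = (a * ((-1) ^ k * (p / q))) * (- x / y)"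
    for a p q x y :: real by simp
  have "(real N + 1) / (real n + 1) * ((-1) ^ Suc k * (pochhammer (real n - real N) (Suc k) / pochhammer (real n + 2) (Suc k)))
    = ((real N + 1) / (real n + 1) * ((-1) ^ k * (pochhammer (real n - real N) k / pochhammer (real n + 2) k)))
      * (- (real n - real N + real k) / (real n + 2 + real k))"
    unfolding pochhammer_Suc by (rule regroup)
  also have "\<dots> = binom_coeff N (n + 1 + Suc k) / real (N choose n)"
    unfolding Suc.IH s by simp
  finally show ?case .
qed

lemma weight_entry_eq_weight_trig:
  assumes "m \<le> n" "n \<le> N" "0 \<le> \<theta>" "\<theta> \<le> pi"
  shows "weight_entry N (cos \<theta>) n m = weight_trig N n m \<theta>"
proof -
  have sq: "sqrt (1 - (cos \<theta>)\<^sup>2) = sin \<theta>"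
    using sin_ge_zero[OF assms(3,4)] by (simp add: cos_squared_eq)
  have fm: "fact (N - m) * fact m / fact N = 1 / real (N choose m)"
    using assms by (simp add: binomial_fact field_simps)
  have summand: "(real N + 1) / (real n + 1) *
       ((-1) ^ (m - t) * (pochhammer (real n - real N) (m - t) / pochhammer (real n + 2) (m - t)) *
         (pochhammer (real N + 2 - real t) t / fact t) * chebyshev_U (n + m - 2 * t) (cos \<theta>)) * sin \<theta>
      = binom_coeff N t * binom_coeff N (n + m + 1 - t) *
          sin ((real (n + m + 1) - 2 * real t) * \<theta>) / real (N choose n)"
    if t: "t \<le> m" for t
  proof -
    have idx: "n + 1 + (m - t) = n + m + 1 - t" using t by simp
    have 1: "(real N + 1) / (real n + 1) * ((-1) ^ (m - t) * (pochhammer (real n - real N) (m - t) / pochhammer (real n + 2) (m - t)))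
        = binom_coeff N (n + m + 1 - t) / real (N choose n)"
      using pochhammer_ratio_binom_coeff[OF assms(2), of "m - t"] unfolding idx .
    have 2: "pochhammer (real N + 2 - real t) t / fact t = binom_coeff N t"
      using gbinomial_pochhammer'[of "real (Suc N)" t]
      by (simp add: binom_coeff_def binomial_gbinomial algebra_simps)
    have "real (n + m - 2 * t) + 1 = real (n + m + 1) - 2 * real t"
      using t assms(1) by (simp add: of_nat_diff)
    then have 3: "sin \<theta> * chebyshev_U (n + m - 2 * t) (cos \<theta>) = sin ((real (n + m + 1) - 2 * real t) * \<theta>)"
      using sin_mult_chebyshev_U[of \<theta> "n + m - 2 * t"] by (simp only:)
    have "(real N + 1) / (real n + 1) *
       ((-1) ^ (m - t) * (pochhammer (real n - real N) (m - t) / pochhammer (real n + 2) (m - t)) *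
         (pochhammer (real N + 2 - real t) t / fact t) * chebyshev_U (n + m - 2 * t) (cos \<theta>)) * sin \<theta>
     = ((real N + 1) / (real n + 1) * ((-1) ^ (m - t) * (pochhammer (real n - real N) (m - t) / pochhammer (real n + 2) (m - t)))) *
       (pochhammer (real N + 2 - real t) t / fact t) * (sin \<theta> * chebyshev_U (n + m - 2 * t) (cos \<theta>))"
      by (simp only: mult_ac)
    then show ?thesis unfolding 1 2 3 by simp
  qed
  have "weight_entry N (cos \<theta>) n m = 1 / real (N choose m) *
     (\<Sum>t=0..m. (real N + 1) / (real n + 1) *
       ((-1) ^ (m - t) * (pochhammer (real n - real N) (m - t) / pochhammer (real n + 2) (m - t)) *
         (pochhammer (real N + 2 - real t) t / fact t) * chebyshev_U (n + m - 2 * t) (cos \<theta>)) * sin \<theta>)"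
    unfolding weight_entry_def sq fm by (simp only: sum_distrib_left sum_distrib_right mult_ac)
  also have "\<dots> = 1 / real (N choose m) *
     (\<Sum>t=0..m. binom_coeff N t * binom_coeff N (n + m + 1 - t) *
          sin ((real (n + m + 1) - 2 * real t) * \<theta>) / real (N choose n))"
    by (intro arg_cong2[where f = "(*)"] sum.cong refl) (auto simp only: summand atLeastAtMost_iff)
  also have "\<dots> = weight_trig N n m \<theta>"
    unfolding weight_trig_def sine_sum_def
    by (simp add: sum_divide_distrib[symmetric] atLeast0AtMost lessThan_Suc_atMost)
  finally show ?thesis .
qed

lemma weight_eq_weight_trig:
  assumes "n \<le> N" "m \<le> N" "-1 \<le> x" "x \<le> 1"
  shows "weight N x $$ (n, m) = complex_of_real (weight_trig N n m (arccos x))"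
proof -
  have *: "weight_entry N x i j = weight_trig N i j (arccos x)" if "j \<le> i" "i \<le> N" for i j
    using weight_entry_eq_weight_trig[OF that, of "arccos x"] assms
    by (simp add: arccos_lbound arccos_ubound cos_arccos)
  show ?thesis
    using assms * weight_trig_sym by (auto simp: weight_def)
qed

section \<open>The symmetry equations\<close>

definition B1_entry :: "nat \<Rightarrow> nat \<Rightarrow> nat \<Rightarrow> real \<Rightarrow> real" where
  "B1_entry N i j x =
     (if j = i + 1 then (2 * real N + 3) * (real i - real N) / real N
      else if j = i then - (2 * (real N + 3) * (real i - real N) / real N) * x
      else if i = j + 1 then 3 * real i / real N else 0)"

text \<open>
  The coefficients are best expressed through \<open>\<kappa> = (N + 3) / N\<close>: the part of \<open>B\<^sub>1\<close> without \<open>\<kappa>\<close> is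
  invariant and the part proportional to \<open>\<kappa>\<close> changes sign under reversal of the indices, up to a
  multiple of the identity.\<close>

lemma sum_B1_entry:
  assumes "N > 0" "n \<le> N" "\<kappa> = (real N + 3) / real N"
  shows "(\<Sum>r<N + 1. B1_entry N n r x * g r) =
     (\<kappa> + 1) * (real n - real N) * g (Suc n) - 2 * \<kappa> * (real n - real N) * x * g n
       + (\<kappa> - 1) * real n * g (n - 1)"
proof -
  have B: "B1_entry N n r x =
     (if r = n + 1 then (\<kappa> + 1) * (real n - real N)
      else if r = n then - 2 * \<kappa> * (real n - real N) * x
      else if n = r + 1 then (\<kappa> - 1) * real n else 0)" for r
  proof -
    have "(2 * real N + 3) * (real n - real N) / real N = (\<kappa> + 1) * (real n - real N)"
      "3 * real n / real N = (\<kappa> - 1) * real n"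
      "- (2 * (real N + 3) * (real n - real N) / real N) * x = - 2 * \<kappa> * (real n - real N) * x"
      using assms(1) by (simp_all add: assms(3) field_simps)
    then show ?thesis by (simp only: B1_entry_def)
  qed
  have e: "B1_entry N n r x * g r =
      (if r = Suc n then (\<kappa> + 1) * (real n - real N) * g (Suc n) else 0)
      + (if r = n then - 2 * \<kappa> * (real n - real N) * x * g n else 0)
      + (if r = n - 1 then (\<kappa> - 1) * real n * g (n - 1) else 0)" for r
    unfolding B by (cases n) auto
  show ?thesis
    unfolding e sum.distrib using assms(2) by (cases "n = N") (auto simp: sum.delta algebra_simps)
qed

text \<open>
  The tridiagonal coefficients turn the binomial normalisation of a neighbouring entry into that of the
  entry itself.  At the ends the left-hand sides are zero through their first factor.  The right-hand
  sides are zero too: for \<open>n = N\<close> every summand contains a binomial coefficient out of range, and for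
  \<open>n = 0\<close> the sum is antisymmetric.\<close>

lemma weight_trig_neighbours:
  assumes "n \<le> N" "m \<le> N"
  shows "(real N - real n) * (real (N choose n) * real (N choose m) * weight_trig N (Suc n) m \<theta>)
      = (real n + 1) * sine_sum N (n + m + 2) (m + 1) \<theta>"
    "real n * (real (N choose n) * real (N choose m) * weight_trig N (n - 1) m \<theta>)
      = (real N + 1 - real n) * sine_sum N (n + m) (m + 1) \<theta>"
    "real (N choose n) * real (N choose m) * weight_trig N n m \<theta> = sine_sum N (n + m + 1) (m + 1) \<theta>"
proof -
  have pm: "real (N choose m) > 0" "real (N choose n) > 0" using assms by simp_all
  show "(real N - real n) * (real (N choose n) * real (N choose m) * weight_trig N (Suc n) m \<theta>)
      = (real n + 1) * sine_sum N (n + m + 2) (m + 1) \<theta>"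
  proof (cases "n = N")
    case True
    have "sine_sum N (n + m + 2) (m + 1) \<theta> = 0"
      unfolding sine_sum_def by (intro sum.neutral) (auto simp: True binom_coeff_def binomial_eq_0)
    then show ?thesis by (simp add: True)
  next
    case False
    then have p: "real (N choose Suc n) > 0" using assms by simp
    have "Suc n * (N choose Suc n) = (N - n) * (N choose n)"
      by (metis binomial_absorb_comp binomial_absorption)
    then have "(real n + 1) * real (N choose Suc n) = (real N - real n) * real (N choose n)"
      using assms(1) by (metis of_nat_Suc of_nat_mult of_nat_diff add.commute)
    then show ?thesis using p pm
      by (simp add: weight_trig_def divide_simps)
  qed
  show "real n * (real (N choose n) * real (N choose m) * weight_trig N (n - 1) m \<theta>)
      = (real N + 1 - real n) * sine_sum N (n + m) (m + 1) \<theta>"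
  proof (cases n)
    case 0
    have "sine_sum N m (m + 1) \<theta> = sine_sum N m 0 \<theta>"
      by (intro sine_sum_reflect) simp
    then show ?thesis by (simp add: 0 sine_sum_def)
  next
    case (Suc j)
    then have p: "real (N choose j) > 0" using assms by simp
    have "Suc j * (N choose Suc j) = (N - j) * (N choose j)"
      by (metis binomial_absorb_comp binomial_absorption)
    then have "(1 + real j) * real (N choose Suc j) = (real N - real j) * real (N choose j)"
      using assms(1) Suc by (metis of_nat_Suc of_nat_mult of_nat_diff add.commute Suc_leD)
    then show ?thesis using p pm
      by (simp add: Suc weight_trig_def divide_simps)
  qed
  show "real (N choose n) * real (N choose m) * weight_trig N n m \<theta> = sine_sum N (n + m + 1) (m + 1) \<theta>"
    using pm by (simp add: weight_trig_def)
qed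

text \<open>
  Row \<open>n\<close> of \<open>B\<^sub>1 W\<close>, and the transposed entry rewritten with the same number of summands, which
  produces the boundary terms.\<close>

lemma B1_weight_entries:
  assumes "N > 0" "n \<le> N" "m \<le> N" "\<kappa> = (real N + 3) / real N"
  shows "real (N choose n) * real (N choose m) *
       (\<Sum>r<N + 1. B1_entry N n r (cos \<theta>) * weight_trig N r m \<theta>)
     = (\<kappa> - 1) * (real N + 1 - real n) * sine_sum N (n + m) (m + 1) \<theta>
       - (\<kappa> + 1) * (real n + 1) * sine_sum N (n + m + 2) (m + 1) \<theta>
       - 2 * \<kappa> * (real n - real N) * cos \<theta> * sine_sum N (n + m + 1) (m + 1) \<theta>"
    (is "?c * ?s = _")
    "real (N choose n) * real (N choose m) *
       (\<Sum>r<N + 1. B1_entry N m r (cos \<theta>) * weight_trig N r n \<theta>)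
     = (\<kappa> - 1) * ((real N + 1 - real m) * sine_sum N (n + m) (m + 1) \<theta>
          - (real m + 1) * binom_coeff N (m + 1) * binom_coeff N n * sin ((real n - real m) * \<theta>))
       - (\<kappa> + 1) * ((real m + 1) * sine_sum N (n + m + 2) (m + 1) \<theta>
          + (real m + 1) * binom_coeff N (m + 1) * binom_coeff N (n + 1) * sin ((real n - real m) * \<theta>))
       - 2 * \<kappa> * (real m - real N) * cos \<theta> * sine_sum N (n + m + 1) (m + 1) \<theta>"
proof -
  have gen: "real (N choose i) * real (N choose j) *
       (\<Sum>r<N + 1. B1_entry N i r (cos \<theta>) * weight_trig N r j \<theta>)
     = (\<kappa> - 1) * (real N + 1 - real i) * sine_sum N (i + j) (j + 1) \<theta>
       - (\<kappa> + 1) * (real i + 1) * sine_sum N (i + j + 2) (j + 1) \<theta>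
       - 2 * \<kappa> * (real i - real N) * cos \<theta> * sine_sum N (i + j + 1) (j + 1) \<theta>"
    if ij: "i \<le> N" "j \<le> N" for i j
  proof -
    have "real (N choose i) * real (N choose j) *
       (\<Sum>r<N + 1. B1_entry N i r (cos \<theta>) * weight_trig N r j \<theta>)
      = (\<kappa> - 1) * (real i * (real (N choose i) * real (N choose j) * weight_trig N (i - 1) j \<theta>))
       - (\<kappa> + 1) * ((real N - real i) * (real (N choose i) * real (N choose j) * weight_trig N (Suc i) j \<theta>))
       - 2 * \<kappa> * (real i - real N) * cos \<theta> * (real (N choose i) * real (N choose j) * weight_trig N i j \<theta>)"
      unfolding sum_B1_entry[OF assms(1) ij(1) assms(4)] by (simp add: algebra_simps)
    then show ?thesis unfolding weight_trig_neighbours[OF ij] by simp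
  qed
  show "?c * ?s = (\<kappa> - 1) * (real N + 1 - real n) * sine_sum N (n + m) (m + 1) \<theta>
       - (\<kappa> + 1) * (real n + 1) * sine_sum N (n + m + 2) (m + 1) \<theta>
       - 2 * \<kappa> * (real n - real N) * cos \<theta> * sine_sum N (n + m + 1) (m + 1) \<theta>"
    by (rule gen[OF assms(2,3)])
  have r: "sine_sum N (m + n + 1) (n + 1) \<theta> = sine_sum N (n + m + 1) (m + 1) \<theta>"
    "sine_sum N (m + n) (n + 1) \<theta> = sine_sum N (n + m) m \<theta>"
    "sine_sum N (m + n + 2) (n + 1) \<theta> = sine_sum N (n + m + 2) (m + 2) \<theta>"
    using sine_sum_reflect[of "n + 1" "m + 1" "m + n + 1" N \<theta>]
      sine_sum_reflect[of "n + 1" m "m + n" N \<theta>]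
      sine_sum_reflect[of "n + 1" "m + 2" "m + n + 2" N \<theta>]
    by (simp_all add: add.commute)
  have b: "(real m + 1) * binom_coeff N (m + 1) = (real N + 1 - real m) * binom_coeff N m"
    using binom_coeff_Suc[of m N] by simp
  have t1: "(real N + 1 - real m) * sine_sum N (n + m) m \<theta> = (real N + 1 - real m) * sine_sum N (n + m) (m + 1) \<theta>
      - (real m + 1) * binom_coeff N (m + 1) * binom_coeff N n * sin ((real n - real m) * \<theta>)"
    unfolding b by (simp add: sine_sum_def algebra_simps)
  have t2: "sine_sum N (n + m + 2) (m + 2) \<theta> = sine_sum N (n + m + 2) (m + 1) \<theta>
      + binom_coeff N (m + 1) * binom_coeff N (n + 1) * sin ((real n - real m) * \<theta>)"
    by (simp add: sine_sum_def algebra_simps)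
  show "real (N choose n) * real (N choose m) *
       (\<Sum>r<N + 1. B1_entry N m r (cos \<theta>) * weight_trig N r n \<theta>)
     = (\<kappa> - 1) * ((real N + 1 - real m) * sine_sum N (n + m) (m + 1) \<theta>
          - (real m + 1) * binom_coeff N (m + 1) * binom_coeff N n * sin ((real n - real m) * \<theta>))
       - (\<kappa> + 1) * ((real m + 1) * sine_sum N (n + m + 2) (m + 1) \<theta>
          + (real m + 1) * binom_coeff N (m + 1) * binom_coeff N (n + 1) * sin ((real n - real m) * \<theta>))
       - 2 * \<kappa> * (real m - real N) * cos \<theta> * sine_sum N (n + m + 1) (m + 1) \<theta>"
    unfolding mult.commute[of "real (N choose n)"] gen[OF assms(3,2)] r
    unfolding t2 mult.assoc[of "\<kappa> - 1"] t1 by (simp add: algebra_simps)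
qed

lemma B0_entry_diff:
  assumes "N > 0" "\<kappa> = (real N + 3) / real N"
  shows "B0_entry N n - B0_entry N m
    = (real n - real m) * (real n + real m - real N - \<kappa> * (real N + 2))"
proof -
  have "real N * B0_entry N i = (real i - real N) * (real i * real N - (real N)\<^sup>2 - 5 * real N - 6)" for i
    using assms(1) by (simp add: B0_entry_def power2_eq_square field_simps)
  from this[of n] this[of m]
  have "real N * (B0_entry N n - B0_entry N m)
    = real N * (real n - real m) * (real n + real m - real N) - (real N + 3) * (real N + 2) * (real n - real m)"
    by (simp add: power2_eq_square algebra_simps)
  also have "\<dots> = real N * ((real n - real m) * (real n + real m - real N - \<kappa> * (real N + 2)))"
  proof -
    have "real N * (\<kappa> * (real N + 2)) = (real N + 3) * (real N + 2)" using assms by simp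
    moreover have "real N * ((real n - real m) * (real n + real m - real N - \<kappa> * (real N + 2)))
        = real N * (real n - real m) * (real n + real m - real N)
          - real N * (\<kappa> * (real N + 2)) * (real n - real m)"
      by (simp add: algebra_simps)
    ultimately show ?thesis by simp
  qed
  finally show ?thesis using assms(1) by simp
qed

text \<open>
  The two symmetry equations in the variable \<open>\<theta>\<close>.  After clearing the binomials, the first is the
  combination of the first two identities for \<open>sine_sum\<close> with coefficients \<open>-\<kappa>\<close> and \<open>1\<close>, and the
  second that of the last two with coefficients \<open>-1\<close> and \<open>-\<kappa>\<close>; the
  common factor \<open>n - m\<close> appears because differentiating the boundary term brings out its frequency.\<close>

lemma symmetry_equations_trig:
  assumes "N > 0" "n \<le> N" "m \<le> N"
  defines "bw \<equiv> \<lambda>k l \<theta>. \<Sum>r<N + 1. B1_entry N k r (cos \<theta>) * weight_trig N r l \<theta>"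
  shows "\<exists>w'. (weight_trig N n m has_real_derivative w') (at \<theta>) \<and>
      sin \<theta> * w' + 2 * cos \<theta> * weight_trig N n m \<theta> = (bw n m \<theta> + bw m n \<theta>) / 2"
    "((\<lambda>\<theta>. (bw n m \<theta> - bw m n \<theta>) / 2) has_real_derivative
      - sin \<theta> * ((B0_entry N n - B0_entry N m) * weight_trig N n m \<theta>)) (at \<theta>)"
proof -
  define \<kappa> where "\<kappa> = (real N + 3) / real N"
  define c where "c = real (N choose n) * real (N choose m)"
  have c: "c > 0" using assms by (simp add: c_def)
  define b where "b = (real m + 1) * binom_coeff N (m + 1)"
  have eq: "n + Suc m = Suc (n + m)" by simp
  note id = sine_sum_identities[OF eq, where N = N and \<theta> = \<theta>]
  define f0 f1 where "f0 = binom_coeff N n" and "f1 = binom_coeff N (Suc n)"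
  define Zp Z0 Zm where "Zp = sine_sum N (n + m + 2) (m + 1)" and "Z0 = sine_sum N (n + m + 1) (m + 1)"
    and "Zm = sine_sum N (n + m) (m + 1)"
  define Dp D0 Dm where "Dp = sine_sum_deriv N (n + m + 2) (m + 1)" and "D0 = sine_sum_deriv N (n + m + 1) (m + 1)"
    and "Dm = sine_sum_deriv N (n + m) (m + 1)"
  note defs = f0_def f1_def b_def Zp_def Z0_def Zm_def Dp_def D0_def Dm_def
  have R1: "(2 * real N - (real n + real m) + 2) * Zm \<theta> - (real n + real m + 2) * Zp \<theta>
     - 2 * cos \<theta> * (real n + real m - real N) * Z0 \<theta> - b * (f1 + f0) * sin ((real n - real m) * \<theta>) = 0"
   and R2: "2 * sin \<theta> * D0 \<theta> - 2 * cos \<theta> * (real N + 1) * Z0 \<theta>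
     + (real n + real m + 2) * Zp \<theta> + (2 * real N - (real n + real m) + 2) * Zm \<theta>
     + b * (f1 - f0) * sin ((real n - real m) * \<theta>) = 0"
   and E1: "Dp \<theta> - Dm \<theta> - 2 * sin \<theta> * (real n + real m - real N) * Z0 \<theta>
     - b * (f1 - f0) * cos ((real n - real m) * \<theta>) = 0"
   and E2: "Dp \<theta> + Dm \<theta> + 2 * cos \<theta> * D0 \<theta> + 2 * sin \<theta> * (real N + 1) * Z0 \<theta>
     - b * (f1 + f0) * cos ((real n - real m) * \<theta>) = 0"
    using id unfolding defs by (simp_all add: algebra_simps)
  have w: "weight_trig N n m = (\<lambda>\<theta>. Z0 \<theta> / c)"
    by (simp add: fun_eq_iff weight_trig_def Z0_def c_def)
  have bw1: "bw n m = (\<lambda>\<theta>. ((\<kappa> - 1) * (real N + 1 - real n) * Zm \<theta> - (\<kappa> + 1) * (real n + 1) * Zp \<theta>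
       - 2 * \<kappa> * (real n - real N) * cos \<theta> * Z0 \<theta>) / c)"
    by (rule ext, rule nonzero_eq_divide_eq[OF c[THEN less_imp_neq, THEN not_sym], THEN iffD2])
      (simp only: bw_def defs c_def mult.commute[of "sum _ _"] B1_weight_entries(1)[OF assms(1-3) \<kappa>_def])
  have bw2: "bw m n = (\<lambda>\<theta>. ((\<kappa> - 1) * ((real N + 1 - real m) * Zm \<theta> - b * f0 * sin ((real n - real m) * \<theta>))
       - (\<kappa> + 1) * ((real m + 1) * Zp \<theta> + b * f1 * sin ((real n - real m) * \<theta>))
       - 2 * \<kappa> * (real m - real N) * cos \<theta> * Z0 \<theta>) / c)"
    by (rule ext, rule nonzero_eq_divide_eq[OF c[THEN less_imp_neq, THEN not_sym], THEN iffD2])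
      (simp only: bw_def defs c_def mult.commute[of "sum _ _"] B1_weight_entries(2)[OF assms(1-3) \<kappa>_def] Suc_eq_plus1)
  have dZ[derivative_intros]: "(Z0 has_real_derivative D0 \<theta>) (at \<theta>)" "(Zp has_real_derivative Dp \<theta>) (at \<theta>)"
    "(Zm has_real_derivative Dm \<theta>) (at \<theta>)"
    by (auto simp: defs has_deriv_sine_sum)
  have "sin \<theta> * D0 \<theta> + 2 * cos \<theta> * Z0 \<theta> =
     (((\<kappa> - 1) * (real N + 1 - real n) * Zm \<theta> - (\<kappa> + 1) * (real n + 1) * Zp \<theta>
       - 2 * \<kappa> * (real n - real N) * cos \<theta> * Z0 \<theta>) +
     ((\<kappa> - 1) * ((real N + 1 - real m) * Zm \<theta> - b * f0 * sin ((real n - real m) * \<theta>))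
       - (\<kappa> + 1) * ((real m + 1) * Zp \<theta> + b * f1 * sin ((real n - real m) * \<theta>))
       - 2 * \<kappa> * (real m - real N) * cos \<theta> * Z0 \<theta>)) / 2" (is "?l = ?r / 2")
  proof -
    have kN: "\<kappa> * real N = real N + 3" using assms(1) by (simp add: \<kappa>_def)
    have "2 * ?l - ?r = - \<kappa> * ((2 * real N - (real n + real m) + 2) * Zm \<theta> - (real n + real m + 2) * Zp \<theta>
     - 2 * cos \<theta> * (real n + real m - real N) * Z0 \<theta> - b * (f1 + f0) * sin ((real n - real m) * \<theta>)) +
     (2 * sin \<theta> * D0 \<theta> - 2 * cos \<theta> * (real N + 1) * Z0 \<theta>
     + (real n + real m + 2) * Zp \<theta> + (2 * real N - (real n + real m) + 2) * Zm \<theta>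
     + b * (f1 - f0) * sin ((real n - real m) * \<theta>))
     - 2 * (\<kappa> * real N - (real N + 3)) * cos \<theta> * Z0 \<theta>"
      by (simp add: algebra_simps)
    then show ?thesis unfolding R1 R2 kN by simp
  qed
  moreover have "sin \<theta> * (D0 \<theta> / c) + 2 * cos \<theta> * (Z0 \<theta> / c) = (sin \<theta> * D0 \<theta> + 2 * cos \<theta> * Z0 \<theta>) / c"
    by (simp add: add_divide_distrib)
  ultimately have "sin \<theta> * (D0 \<theta> / c) + 2 * cos \<theta> * (Z0 \<theta> / c) = (bw n m \<theta> + bw m n \<theta>) / 2"
    unfolding bw1 bw2 by (simp only: divide_divide_eq_left mult.commute[of 2] add_divide_distrib)
  moreover have "(weight_trig N n m has_real_derivative D0 \<theta> / c) (at \<theta>)"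
    unfolding w using c by (auto intro!: derivative_eq_intros)
  ultimately show "\<exists>w'. (weight_trig N n m has_real_derivative w') (at \<theta>) \<and>
      sin \<theta> * w' + 2 * cos \<theta> * weight_trig N n m \<theta> = (bw n m \<theta> + bw m n \<theta>) / 2"
    unfolding w by blast
  let ?k = "real n - real m"
  have bwd: "(\<lambda>\<theta>. (bw n m \<theta> - bw m n \<theta>) / 2) = (\<lambda>\<theta>. (?k * (- (\<kappa> - 1) * Zm \<theta>
        - (\<kappa> + 1) * Zp \<theta> - 2 * \<kappa> * cos \<theta> * Z0 \<theta>)
       + b * ((\<kappa> - 1) * f0 + (\<kappa> + 1) * f1) * sin (?k * \<theta>)) / (2 * c))"
    unfolding bw1 bw2 using c by (simp add: fun_eq_iff field_simps)
  have E: "- (\<kappa> - 1) * Dm \<theta> - (\<kappa> + 1) * Dp \<theta> - 2 * \<kappa> * (cos \<theta> * D0 \<theta> - sin \<theta> * Z0 \<theta>)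
        + b * ((\<kappa> - 1) * f0 + (\<kappa> + 1) * f1) * cos (?k * \<theta>)
      = - 2 * sin \<theta> * (real n + real m - real N - \<kappa> * (real N + 2)) * Z0 \<theta>" (is "?l = ?r")
  proof -
    have "?l - ?r = - \<kappa> * (Dp \<theta> + Dm \<theta> + 2 * cos \<theta> * D0 \<theta> + 2 * sin \<theta> * (real N + 1) * Z0 \<theta>
     - b * (f1 + f0) * cos (?k * \<theta>)) - (Dp \<theta> - Dm \<theta> - 2 * sin \<theta> * (real n + real m - real N) * Z0 \<theta>
     - b * (f1 - f0) * cos (?k * \<theta>))"
      by (simp add: algebra_simps)
    then show ?thesis unfolding E1 E2 by simp
  qed
  show "((\<lambda>\<theta>. (bw n m \<theta> - bw m n \<theta>) / 2) has_real_derivative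
      - sin \<theta> * ((B0_entry N n - B0_entry N m) * weight_trig N n m \<theta>)) (at \<theta>)"
  proof -
    have "((\<lambda>\<theta>. (bw n m \<theta> - bw m n \<theta>) / 2) has_real_derivative
       ?k * (- (\<kappa> - 1) * Dm \<theta> - (\<kappa> + 1) * Dp \<theta> - 2 * \<kappa> * (cos \<theta> * D0 \<theta> - sin \<theta> * Z0 \<theta>)
        + b * ((\<kappa> - 1) * f0 + (\<kappa> + 1) * f1) * cos (?k * \<theta>)) / (2 * c)) (at \<theta>)"
      unfolding bwd by (rule DERIV_cdivide) (auto intro!: derivative_eq_intros simp: algebra_simps)
    moreover have "?k * (- 2 * sin \<theta> * e * Z0 \<theta>) / (2 * c) = - sin \<theta> * ((?k * e) * (Z0 \<theta> / c))" for e
      by simp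
    ultimately show ?thesis
      unfolding E B0_entry_diff[OF assms(1) \<kappa>_def] w by (simp only:)
  qed
qed

section \<open>Positivity of the weight\<close>

text \<open>
  The vectors of a Gram representation of the weight at \<open>z = cis \<theta>\<close>: the coefficients of
  \<open>(1 + u z)\<^sup>j (1 + u / z)\<^sup>M\<^sup>-\<^sup>j\<close>, where \<open>1 / z\<close> is written as the conjugate of \<open>z\<close>.\<close>

definition lin_prod :: "complex \<Rightarrow> nat \<Rightarrow> nat \<Rightarrow> complex poly" where
  "lin_prod z M j = [:1, z:] ^ j * [:1, cnj z:] ^ (M - j)"

lemma lin_prod_Suc:
  "lin_prod z (Suc M) (Suc j) = [:1, z:] * lin_prod z M j"
  "j \<le> M \<Longrightarrow> lin_prod z (Suc M) j = [:1, cnj z:] * lin_prod z M j"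
  by (simp_all add: lin_prod_def Suc_diff_le mult_ac del: mult_pCons_left mult_pCons_right)

lemma coeff_one_plus_mult:
  "coeff ([:1, z:] * p) 0 = coeff p 0"
  "coeff ([:1, z:] * p) (Suc n) = coeff p (Suc n) + z * coeff p (n::nat)" for z :: complex
  by simp_all

lemma coeff_one_plus_power: "coeff ([:1, z:] ^ Suc N) k = of_real (binom_coeff N k) * z ^ k" for z :: complex
proof (cases "k \<le> Suc N")
  case True
  then show ?thesis using coeff_linear_poly_power[OF True, of 1 z] by (simp add: binom_coeff_def)
next
  case False
  have "degree ([:1, z:] ^ Suc N) \<le> Suc N"
    using degree_power_le[of "[:1, z:]" "Suc N"] by (simp split: if_splits del: power_Suc)
  then have "coeff ([:1, z:] ^ Suc N) k = 0" using False by (intro coeff_eq_0) linarith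
  then show ?thesis using False
    by (simp add: binom_coeff_def binomial_eq_0 del: power_Suc)
qed

definition gram_entry :: "complex \<Rightarrow> nat \<Rightarrow> nat \<Rightarrow> nat \<Rightarrow> complex" where
  "gram_entry z N n m = (\<Sum>j<Suc N. coeff (lin_prod z N j) n * cnj (coeff (lin_prod z N j) m))"

text \<open>
  Write \<open>1 / z\<close> for the conjugate of \<open>z\<close>.  With \<open>p = (1 + u z) (1 + v / z)\<close> and \<open>q = (1 + u / z) (1 + v z)\<close> one has
  \<open>p - q = (z - 1 / z) (u - v)\<close>, and the generating function of the Gram matrix is
  \<open>\<Sum>\<^sub>j p\<^sup>j q\<^sup>N\<^sup>-\<^sup>j\<close>.  These are the coefficients of \<open>(p - q) \<Sum>\<^sub>j p\<^sup>j q\<^sup>N\<^sup>-\<^sup>j = p\<^sup>N\<^sup>+\<^sup>1 - q\<^sup>N\<^sup>+\<^sup>1\<close>.\<close>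

lemma gram_telescope:
  "(z - cnj z) * gram_entry z N n 0
     = of_real (binom_coeff N (Suc n)) * (z ^ Suc n - cnj z ^ Suc n)"
  "(z - cnj z) * (gram_entry z N n (Suc m) - gram_entry z N (Suc n) m)
     = of_real (binom_coeff N (Suc m) * binom_coeff N (Suc n)) *
       (z ^ Suc n * cnj z ^ Suc m - cnj z ^ Suc n * z ^ Suc m)"
proof -
  define T where "T k j = coeff (lin_prod z (Suc N) j) (Suc n) * cnj (coeff (lin_prod z (Suc N) j) k)" for k j
  have T: "(\<Sum>j<Suc N. T k (Suc j) - T k j)
      = of_real (binom_coeff N k * binom_coeff N (Suc n)) * (z ^ Suc n * cnj z ^ k - cnj z ^ Suc n * z ^ k)" for k
    unfolding sum_lessThan_telescope
    by (simp only: T_def lin_prod_def diff_self_eq_0 diff_zero power_0 mult_1_left mult_1_right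
          coeff_one_plus_power complex_cnj_mult complex_cnj_power complex_cnj_complex_of_real
          complex_cnj_cnj of_real_mult) (simp add: algebra_simps)
  have "(z - cnj z) * gram_entry z N n 0 = (\<Sum>j<Suc N. T 0 (Suc j) - T 0 j)"
    unfolding gram_entry_def sum_distrib_left
  proof (intro sum.cong refl)
    fix j assume "j \<in> {..<Suc N}"
    then have "j \<le> N" by simp
    then show "(z - cnj z) * (coeff (lin_prod z N j) n * cnj (coeff (lin_prod z N j) 0)) = T 0 (Suc j) - T 0 j"
      unfolding T_def lin_prod_Suc(1) lin_prod_Suc(2)[OF \<open>j \<le> N\<close>] coeff_one_plus_mult by (simp add: algebra_simps)
  qed
  then show "(z - cnj z) * gram_entry z N n 0
     = of_real (binom_coeff N (Suc n)) * (z ^ Suc n - cnj z ^ Suc n)"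
    unfolding T by (simp add: binom_coeff_def del: power_Suc)
  have "(z - cnj z) * (gram_entry z N n (Suc m) - gram_entry z N (Suc n) m) = (\<Sum>j<Suc N. T (Suc m) (Suc j) - T (Suc m) j)"
    unfolding gram_entry_def sum_subtractf[symmetric] sum_distrib_left
  proof (intro sum.cong refl)
    fix j assume "j \<in> {..<Suc N}"
    then have "j \<le> N" by simp
    then show "(z - cnj z) * (coeff (lin_prod z N j) n * cnj (coeff (lin_prod z N j) (Suc m))
        - coeff (lin_prod z N j) (Suc n) * cnj (coeff (lin_prod z N j) m)) = T (Suc m) (Suc j) - T (Suc m) j"
      unfolding T_def lin_prod_Suc(1) lin_prod_Suc(2)[OF \<open>j \<le> N\<close>] coeff_one_plus_mult by (simp add: algebra_simps)
  qed
  then show "(z - cnj z) * (gram_entry z N n (Suc m) - gram_entry z N (Suc n) m)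
     = of_real (binom_coeff N (Suc m) * binom_coeff N (Suc n)) *
       (z ^ Suc n * cnj z ^ Suc m - cnj z ^ Suc n * z ^ Suc m)"
    unfolding T .
qed

lemma cis_power_diff:
  "cis \<theta> ^ n * cnj (cis \<theta>) ^ m - cnj (cis \<theta>) ^ n * cis \<theta> ^ m
     = 2 * \<i> * of_real (sin ((real n - real m) * \<theta>))"
  by (simp add: cis_cnj Complex.DeMoivre cis_mult complex_eq_iff sin_add sin_diff cos_add cos_diff left_diff_distrib)

text \<open>
  Lengthening the sum by one term is the same recursion as the telescoped one.\<close>

lemma sine_sum_eq_gram:
  assumes "sin \<theta> \<noteq> 0"
  shows "complex_of_real (sine_sum N (n + m + 1) (m + 1) \<theta>) = of_real (sin \<theta>) * gram_entry (cis \<theta>) N n m"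
proof (induction m arbitrary: n)
  case 0
  have "2 * \<i> * (of_real (sin \<theta>) * gram_entry (cis \<theta>) N n 0)
      = 2 * \<i> * (of_real (binom_coeff N (Suc n)) * of_real (sin ((real n + 1) * \<theta>)))"
    using gram_telescope(1)[of "cis \<theta>" N n] cis_power_diff[of \<theta> 1 0] cis_power_diff[of \<theta> "Suc n" 0]
    by (simp add: mult_ac add_ac del: power_Suc)
  then show ?case by (simp add: sine_sum_def binom_coeff_def add_ac)
next
  case (Suc m)
  have "2 * \<i> * (of_real (sin \<theta>) * (gram_entry (cis \<theta>) N n (Suc m) - gram_entry (cis \<theta>) N (Suc n) m))
      = 2 * \<i> * of_real (binom_coeff N (Suc m) * binom_coeff N (Suc n) * sin ((real n - real m) * \<theta>))"
    using gram_telescope(2)[of "cis \<theta>" N n m] cis_power_diff[of \<theta> 1 0] cis_power_diff[of \<theta> "Suc n" "Suc m"]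
    by (simp add: mult_ac del: power_Suc)
  then have "of_real (sin \<theta>) * (gram_entry (cis \<theta>) N n (Suc m) - gram_entry (cis \<theta>) N (Suc n) m)
      = complex_of_real (binom_coeff N (Suc m) * binom_coeff N (Suc n) * sin ((real n - real m) * \<theta>))"
    by (simp only: mult_cancel_left) simp
  then have "of_real (sin \<theta>) * gram_entry (cis \<theta>) N n (Suc m)
      = of_real (sin \<theta>) * gram_entry (cis \<theta>) N (Suc n) m
       + complex_of_real (binom_coeff N (Suc m) * binom_coeff N (Suc n) * sin ((real n - real m) * \<theta>))"
    by (simp add: algebra_simps)
  moreover have "sine_sum N (n + Suc m + 1) (Suc m + 1) \<theta> = sine_sum N (Suc n + m + 1) (m + 1) \<theta>
      + binom_coeff N (Suc m) * binom_coeff N (Suc n) * sin ((real n - real m) * \<theta>)"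
    by (simp add: sine_sum_def algebra_simps)
  ultimately show ?case using Suc[of "Suc n"] by (simp del: add_Suc_right)
qed

text \<open>
  The products \<open>lin_prod z N j\<close> span the polynomials of degree at most \<open>N\<close>, because two distinct
  linear factors span \<open>1\<close> and \<open>u\<close>.  In terms of the functional \<open>L\<close> with coefficients \<open>c\<close>: if it kills
  both multiples of a polynomial by these factors, it kills the polynomial and its multiple by \<open>u\<close>, so
  the factors can be traded for powers of \<open>u\<close> one at a time.\<close>

lemma lin_prod_separating:
  assumes "z \<noteq> cnj z" and zero: "\<And>j. j \<le> N \<Longrightarrow> (\<Sum>k\<le>N. c k * coeff (lin_prod z N j) k) = 0" and "k \<le> N"
  shows "c k = 0"
proof -
  define L where "L p = (\<Sum>k\<le>N. c k * coeff p k)" for p :: "complex poly"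
  have Ladd: "L (p + q) = L p + L q" and Lsmult: "L (Polynomial.smult a p) = a * L p" for p q a
    by (simp_all add: L_def algebra_simps sum.distrib sum_distrib_left)
  have "\<forall>i\<le>r. \<forall>j\<le>N - r. L (monom 1 i * lin_prod z (N - r) j) = 0" if "r \<le> N" for r
    using that
  proof (induction r)
    case 0
    then show ?case using zero by (simp add: L_def)
  next
    case (Suc r)
    define M where "M = N - Suc r"
    have M: "N - r = Suc M" using Suc.prems by (simp add: M_def)
    have *: "L (monom 1 i * lin_prod z M j) = 0 \<and> L (monom 1 (Suc i) * lin_prod z M j) = 0"
      if "i \<le> r" "j \<le> M" for i j
    proof -
      let ?p = "monom 1 i * lin_prod z M j" and ?q = "monom 1 (Suc i) * lin_prod z M j"
      have split: "monom 1 i * ([:1, w:] * lin_prod z M j) = ?p + Polynomial.smult w ?q" for w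
      proof -
        have "[:1, w:] = 1 + Polynomial.smult w (monom 1 1)" by (simp add: monom_altdef one_pCons)
        then have "monom 1 i * ([:1, w:] * lin_prod z M j) = ?p + Polynomial.smult w (monom 1 i * monom 1 1 * lin_prod z M j)"
          by (simp only: distrib_left distrib_right mult_1 mult_smult_left mult_smult_right mult.assoc)
        then show ?thesis by (simp add: mult_monom)
      qed
      have "L (monom 1 i * lin_prod z (Suc M) (Suc j)) = 0" "L (monom 1 i * lin_prod z (Suc M) j) = 0"
        using Suc.IH Suc.prems that M by auto
      then have e: "L ?p + z * L ?q = 0" "L ?p + cnj z * L ?q = 0"
        unfolding lin_prod_Suc(1) lin_prod_Suc(2)[OF that(2)] split Ladd Lsmult by auto
      then have "(z - cnj z) * L ?q = 0"
        unfolding left_diff_distrib by (metis add_left_cancel right_minus_eq)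
      then have "L ?q = 0" using assms(1) by simp
      then show ?thesis using e by simp
    qed
    show ?case
    proof (intro allI impI)
      fix i j assume "i \<le> Suc r" "j \<le> N - Suc r"
      then show "L (monom 1 i * lin_prod z (N - Suc r) j) = 0"
        unfolding M_def[symmetric] using *[of i j] *[of "i - 1" j] by (cases i) auto
    qed
  qed
  from this[of N] \<open>k \<le> N\<close> have "L (monom 1 k) = 0" by (force simp: lin_prod_def)
  moreover have "L (monom 1 k) = c k"
    using \<open>k \<le> N\<close> by (simp add: L_def coeff_monom if_distrib[of "\<lambda>x. c _ * x"] cong: if_cong)
  ultimately show ?thesis by simp
qed

lemma sine_sum_positive:
  assumes "sin \<theta> > 0" "\<exists>k<N + 1. c k \<noteq> 0"
  shows "Re (\<Sum>k<N + 1. \<Sum>l<N + 1. c k * of_real (sine_sum N (k + l + 1) (l + 1) \<theta>) * cnj (c l)) > 0"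
proof -
  define z where "z = cis \<theta>"
  define v where "v j = (\<Sum>k<N + 1. c k * coeff (lin_prod z N j) k)" for j
  have "(\<Sum>k<N + 1. \<Sum>l<N + 1. c k * of_real (sine_sum N (k + l + 1) (l + 1) \<theta>) * cnj (c l))
     = (\<Sum>k<N + 1. \<Sum>l<N + 1. \<Sum>j<Suc N. of_real (sin \<theta>) *
          ((c k * coeff (lin_prod z N j) k) * cnj (c l * coeff (lin_prod z N j) l)))"
    unfolding sine_sum_eq_gram[OF assms(1)[THEN less_imp_neq, THEN not_sym]] gram_entry_def z_def[symmetric]
      sum_distrib_left sum_distrib_right
    by (intro sum.cong refl) (simp add: mult_ac)
  also have "\<dots> = (\<Sum>k<N + 1. \<Sum>j<Suc N. \<Sum>l<N + 1. of_real (sin \<theta>) *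
          ((c k * coeff (lin_prod z N j) k) * cnj (c l * coeff (lin_prod z N j) l)))"
    by (intro sum.cong refl sum.swap)
  also have "\<dots> = (\<Sum>j<Suc N. \<Sum>k<N + 1. \<Sum>l<N + 1. of_real (sin \<theta>) *
          ((c k * coeff (lin_prod z N j) k) * cnj (c l * coeff (lin_prod z N j) l)))"
    by (rule sum.swap)
  also have "\<dots> = (\<Sum>j<Suc N. of_real (sin \<theta>) * (v j * cnj (v j)))"
    unfolding v_def cnj_sum sum_product by (simp only: sum_distrib_left)
  also have "\<dots> = of_real (sin \<theta> * (\<Sum>j<Suc N. (cmod (v j))\<^sup>2))"
    by (simp only: sum_distrib_left of_real_mult of_real_sum complex_norm_square)
  finally have eq: "(\<Sum>k<N + 1. \<Sum>l<N + 1. c k * of_real (sine_sum N (k + l + 1) (l + 1) \<theta>) * cnj (c l))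
     = of_real (sin \<theta> * (\<Sum>j<Suc N. (cmod (v j))\<^sup>2))" .
  have "z \<noteq> cnj z" using assms(1) by (simp add: z_def complex_eq_iff)
  note separating = lin_prod_separating[OF this, of N c]
  have "\<exists>j<Suc N. v j \<noteq> 0"
  proof (rule ccontr)
    assume "\<not> (\<exists>j<Suc N. v j \<noteq> 0)"
    then have "(\<Sum>k\<le>N. c k * coeff (lin_prod z N j) k) = 0" if "j \<le> N" for j
      using that unfolding v_def Suc_eq_plus1[symmetric] lessThan_Suc_atMost less_Suc_eq_le by blast
    then have "c k = 0" if "k \<le> N" for k using separating that by blast
    then show False using assms(2) by (metis Suc_eq_plus1 less_Suc_eq_le)
  qed
  then obtain j where "j < Suc N" "v j \<noteq> 0" by blast
  then have "(\<Sum>j<Suc N. (cmod (v j))\<^sup>2) > 0"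
    by (intro sum_pos2[of _ j]) auto
  then show ?thesis unfolding eq using assms(1) by simp
qed

section \<open>Monic orthogonal polynomials for a positive definite matrix weight\<close>

text \<open>
  The entry \<open>(i, j)\<close> of the matrix inner product depends only on row \<open>i\<close> of the first and row \<open>j\<close> of
  the second argument.  It is therefore a scalar sesquilinear form on rows of polynomials, and
  orthogonalisation can be done with scalars instead of matrix coefficients.\<close>

definition row_form ::
  "nat \<Rightarrow> (real \<Rightarrow> complex mat) \<Rightarrow> (nat \<Rightarrow> complex poly) \<Rightarrow> (nat \<Rightarrow> complex poly) \<Rightarrow> complex" where
  "row_form d W p q = integral {-1..1} (\<lambda>x. \<Sum>k<d. \<Sum>l<d.
     poly (p k) (of_real x) * W x $$ (k, l) * cnj (poly (q l) (of_real x)))"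

definition row_degree_less :: "nat \<Rightarrow> nat \<Rightarrow> (nat \<Rightarrow> complex poly) \<Rightarrow> bool" where
  "row_degree_less d n p \<longleftrightarrow> (\<forall>k<d. \<forall>t\<ge>n. coeff (p k) t = 0)"

lemma mult_mat_entry:
  assumes "A \<in> carrier_mat d d" "B \<in> carrier_mat d d" "i < d" "j < d"
  shows "(A * B) $$ (i, j) = (\<Sum>k<d. A $$ (i, k) * B $$ (k, j))"
  using assms by (simp add: scalar_prod_def atLeast0LessThan)

lemma matrix_inner_entry:
  assumes "P \<in> carrier_mat d d" "Q \<in> carrier_mat d d" "\<And>x. W x \<in> carrier_mat d d" "i < d" "j < d"
  shows "matrix_inner d W P Q $$ (i, j) = row_form d W (\<lambda>k. P $$ (i, k)) (\<lambda>k. Q $$ (j, k))"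
proof -
  have "(eval_mat P x * W x * mat_adjoint (eval_mat Q x)) $$ (i, j)
    = (\<Sum>k<d. \<Sum>l<d. poly (P $$ (i, k)) (of_real x) * W x $$ (k, l) * cnj (poly (Q $$ (j, l)) (of_real x)))" for x
  proof -
    have c: "eval_mat P x \<in> carrier_mat d d" "eval_mat Q x \<in> carrier_mat d d"
      using assms by (auto simp: eval_mat_def)
    have a: "mat_adjoint (eval_mat Q x) \<in> carrier_mat d d"
      using c by (auto simp: mat_adjoint_def)
    have adj: "mat_adjoint (eval_mat Q x) $$ (l, j) = cnj (poly (Q $$ (j, l)) (of_real x))" if "l < d" for l
      using that assms c by (simp add: mat_adjoint_def mat_of_rows_def eval_mat_def)
    have "(eval_mat P x * W x * mat_adjoint (eval_mat Q x)) $$ (i, j)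
      = (\<Sum>l<d. (\<Sum>k<d. poly (P $$ (i, k)) (of_real x) * W x $$ (k, l)) * cnj (poly (Q $$ (j, l)) (of_real x)))"
      using assms(4,5) adj
      by (simp add: mult_mat_entry[OF mult_carrier_mat[OF c(1) assms(3)] a] mult_mat_entry[OF c(1) assms(3)])
         (use assms c in \<open>simp add: eval_mat_def\<close>)
    also have "\<dots> = (\<Sum>l<d. \<Sum>k<d. poly (P $$ (i, k)) (of_real x) * W x $$ (k, l) * cnj (poly (Q $$ (j, l)) (of_real x)))"
      by (simp add: sum_distrib_right)
    also have "\<dots> = (\<Sum>k<d. \<Sum>l<d. poly (P $$ (i, k)) (of_real x) * W x $$ (k, l) * cnj (poly (Q $$ (j, l)) (of_real x)))"
      by (rule sum.swap)
    finally show ?thesis .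
  qed
  then show ?thesis using assms by (simp add: matrix_inner_def row_form_def)
qed

locale positive_weight =
  fixes d :: nat and W :: "real \<Rightarrow> complex mat"
  assumes W_carrier: "W x \<in> carrier_mat d d"
    and W_continuous: "\<lbrakk>k < d; l < d\<rbrakk> \<Longrightarrow> continuous_on {-1..1} (\<lambda>x. W x $$ (k, l))"
    and W_hermitian: "\<lbrakk>k < d; l < d; x \<in> {-1..1}\<rbrakk> \<Longrightarrow> W x $$ (l, k) = cnj (W x $$ (k, l))"
    and W_positive: "\<lbrakk>x \<in> {-1<..<1}; \<exists>k<d. v k \<noteq> 0\<rbrakk> \<Longrightarrow>
      Re (\<Sum>k<d. \<Sum>l<d. v k * W x $$ (k, l) * cnj (v l)) > 0"
begin

abbreviation form :: "(nat \<Rightarrow> complex poly) \<Rightarrow> (nat \<Rightarrow> complex poly) \<Rightarrow> complex" where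
  "form \<equiv> row_form d W"

abbreviation deg_less :: "nat \<Rightarrow> (nat \<Rightarrow> complex poly) \<Rightarrow> bool" where
  "deg_less \<equiv> row_degree_less d"

lemma integrand_continuous:
  "continuous_on {-1..1} (\<lambda>x. \<Sum>k<d. \<Sum>l<d.
     poly (p k) (complex_of_real x) * W x $$ (k, l) * cnj (poly (q l) (of_real x)))"
  by (intro continuous_intros W_continuous) auto

lemmas integrand_integrable = integrable_continuous_real[OF integrand_continuous]

lemma form_cong:
  assumes "\<And>k. k < d \<Longrightarrow> p k = p' k" "\<And>k. k < d \<Longrightarrow> q k = q' k"
  shows "form p q = form p' q'"
  unfolding row_form_def using assms by (intro integral_cong sum.cong) auto

lemma form_diff_left: "form (\<lambda>k. p k - p' k) q = form p q - form p' q"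
proof -
  have "form p q - form p' q = integral {-1..1} (\<lambda>x.
     (\<Sum>k<d. \<Sum>l<d. poly (p k) (of_real x) * W x $$ (k, l) * cnj (poly (q l) (of_real x)))
     - (\<Sum>k<d. \<Sum>l<d. poly (p' k) (of_real x) * W x $$ (k, l) * cnj (poly (q l) (of_real x))))"
    unfolding row_form_def by (rule integral_diff[symmetric]) (rule integrand_integrable)+
  then show ?thesis
    by (simp add: row_form_def sum_subtractf[symmetric] left_diff_distrib)
qed

lemma form_smult_left: "form (\<lambda>k. Polynomial.smult a (p k)) q = a * form p q"
proof -
  have "a * form p q = integral {-1..1} (\<lambda>x.
     a * (\<Sum>k<d. \<Sum>l<d. poly (p k) (of_real x) * W x $$ (k, l) * cnj (poly (q l) (of_real x))))"
    unfolding row_form_def by (simp only: integral_mult_right)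
  then show ?thesis
    by (simp add: row_form_def sum_distrib_left mult.assoc)
qed

lemma form_zero_left: "form (\<lambda>k. 0) q = 0"
  by (simp add: row_form_def)

lemma form_zero_right: "form p (\<lambda>k. 0) = 0"
  by (simp add: row_form_def)

lemma form_sum_left:
  "finite B \<Longrightarrow> form (\<lambda>k. \<Sum>b\<in>B. Polynomial.smult (c b) (f b k)) q = (\<Sum>b\<in>B. c b * form (f b) q)"
proof (induction B rule: finite_induct)
  case empty
  then show ?case by (simp add: form_zero_left)
next
  case (insert a B)
  define F where "F S = form (\<lambda>k. \<Sum>b\<in>S. Polynomial.smult (c b) (f b k)) q" for S
  have "F B = form (\<lambda>k. (\<Sum>b\<in>insert a B. Polynomial.smult (c b) (f b k)) - Polynomial.smult (c a) (f a k)) q"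
    unfolding F_def using insert.hyps by (intro form_cong) auto
  then have "F B = F (insert a B) - c a * form (f a) q"
    unfolding F_def form_diff_left form_smult_left .
  moreover have "F B = (\<Sum>b\<in>B. c b * form (f b) q)" unfolding F_def by (rule insert.IH)
  ultimately show ?case unfolding F_def[symmetric] using insert.hyps by simp
qed

lemma form_conj: "form q p = cnj (form p q)"
proof -
  have "cnj (form p q) = integral {-1..1} (\<lambda>x. cnj (\<Sum>k<d. \<Sum>l<d.
     poly (p k) (of_real x) * W x $$ (k, l) * cnj (poly (q l) (of_real x))))"
    unfolding row_form_def
    using integral_linear[OF integrand_integrable bounded_linear_cnj] by (simp add: o_def)
  also have "\<dots> = integral {-1..1} (\<lambda>x. \<Sum>k<d. \<Sum>l<d.
     poly (q k) (of_real x) * W x $$ (k, l) * cnj (poly (p l) (of_real x)))"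
  proof (rule integral_cong)
    fix x :: real assume x: "x \<in> {-1..1}"
    have "cnj (\<Sum>k<d. \<Sum>l<d. poly (p k) (of_real x) * W x $$ (k, l) * cnj (poly (q l) (of_real x)))
      = (\<Sum>k<d. \<Sum>l<d. poly (q l) (of_real x) * W x $$ (l, k) * cnj (poly (p k) (of_real x)))"
      unfolding cnj_sum using W_hermitian[symmetric] x by (intro sum.cong refl) simp
    also have "\<dots> = (\<Sum>l<d. \<Sum>k<d. poly (q l) (of_real x) * W x $$ (l, k) * cnj (poly (p k) (of_real x)))"
      by (rule sum.swap)
    finally show "cnj (\<Sum>k<d. \<Sum>l<d. poly (p k) (of_real x) * W x $$ (k, l) * cnj (poly (q l) (of_real x)))
      = (\<Sum>l<d. \<Sum>k<d. poly (q l) (of_real x) * W x $$ (l, k) * cnj (poly (p k) (of_real x)))" .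
  qed
  finally show ?thesis by (simp add: row_form_def)
qed

lemma form_diff_right: "form p (\<lambda>k. q k - q' k) = form p q - form p q'"
  using form_conj[of p] form_diff_left by simp

lemma form_sum_right:
  "finite B \<Longrightarrow> form p (\<lambda>k. \<Sum>b\<in>B. Polynomial.smult (c b) (f b k)) = (\<Sum>b\<in>B. cnj (c b) * form p (f b))"
  using form_conj[of p] form_sum_left[of B c f p] by simp

text \<open>
  The integrand is continuous and nonnegative, so it vanishes identically, and positivity of the weight
  at interior points makes every entry of the row vanish at infinitely many points.\<close>

lemma form_definite:
  assumes "form p p = 0" "k < d"
  shows "p k = 0"
proof -
  define g where "g x = (\<Sum>k<d. \<Sum>l<d.
     poly (p k) (complex_of_real x) * W x $$ (k, l) * cnj (poly (p l) (of_real x)))" for x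
  have g: "continuous_on {-1..1} g" unfolding g_def by (rule integrand_continuous)
  have Reg: "continuous_on {-1..1} (\<lambda>x. Re (g x))" by (intro continuous_intros g)
  have pos: "Re (g x) \<ge> 0" if "x \<in> {-1<..<1}" for x
  proof (cases "\<exists>k<d. poly (p k) (complex_of_real x) \<noteq> 0")
    case True
    then show ?thesis using W_positive[OF that, of "\<lambda>k. poly (p k) (of_real x)"] by (simp add: g_def)
  qed (simp add: g_def)
  have cl: "closure {-1<..<1::real} = {-1..1}" by simp
  have nonneg: "Re (g x) \<ge> 0" if "x \<in> {-1..1}" for x
    by (rule continuous_ge_on_closure[of "{-1<..<1}"]) (use that Reg pos cl in auto)
  have "(g has_integral 0) {-1..1}"
    using integrable_integral[OF integrable_continuous_real[OF g]] assms(1)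
    unfolding row_form_def g_def[abs_def, symmetric] by simp
  then have "((\<lambda>x. Re (g x)) has_integral 0) {-1..1}"
    using has_integral_linear[OF _ bounded_linear_Re, of g 0 "{-1..1}"] by (simp add: o_def)
  then have zero: "Re (g x) = 0" if "x \<in> {-1..1}" for x
    using has_integral_0_cbox_imp_0[of "-1" "1::real" "\<lambda>x. Re (g x)" x] Reg nonneg that by simp
  have root: "poly (p k) (complex_of_real x) = 0" if "x \<in> {-1<..<1}" for x
  proof (rule ccontr)
    assume "poly (p k) (complex_of_real x) \<noteq> 0"
    then have "Re (g x) > 0"
      using W_positive[OF that, of "\<lambda>k. poly (p k) (of_real x)"] assms(2) by (auto simp: g_def)
    then show False using zero[of x] that by simp
  qed
  have "infinite (complex_of_real ` {-1<..<1})"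
    by (subst finite_image_iff) (auto simp: inj_on_def)
  moreover have "complex_of_real ` {-1<..<1} \<subseteq> {z. poly (p k) z = 0}" using root by auto
  ultimately show ?thesis using poly_roots_finite[of "p k"] finite_subset by blast
qed

text \<open>
  Orthogonal projection onto the span of a finite family, by Gram-Schmidt.  If the component \<open>e1\<close> of the
  new member orthogonal to the old ones has norm zero, it vanishes and the coefficient \<open>0\<close> will do.\<close>

lemma projection_exists:
  assumes "finite B"
  shows "\<exists>c. \<forall>b\<in>B. form (\<lambda>k. p k - (\<Sum>a\<in>B. Polynomial.smult (c a) (f a k))) (f b) = 0"
  using assms
proof (induction B arbitrary: p rule: finite_induct)
  case empty
  then show ?case by simp
next
  case (insert e B)
  obtain c where c: "\<And>b. b \<in> B \<Longrightarrow> form (\<lambda>k. p k - (\<Sum>a\<in>B. Polynomial.smult (c a) (f a k))) (f b) = 0"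
    using insert.IH[of p] by blast
  obtain c' where c': "\<And>b. b \<in> B \<Longrightarrow> form (\<lambda>k. f e k - (\<Sum>a\<in>B. Polynomial.smult (c' a) (f a k))) (f b) = 0"
    using insert.IH[of "f e"] by blast
  define p1 where "p1 k = p k - (\<Sum>a\<in>B. Polynomial.smult (c a) (f a k))" for k
  define e1 where "e1 k = f e k - (\<Sum>a\<in>B. Polynomial.smult (c' a) (f a k))" for k
  have p1: "form p1 (f b) = 0" and e1: "form e1 (f b) = 0" if "b \<in> B" for b
    using c c' that unfolding p1_def e1_def by auto
  have to_e1: "form r (f e) = form r e1" if "\<And>b. b \<in> B \<Longrightarrow> form r (f b) = 0" for r
    unfolding e1_def using that by (simp add: form_diff_right form_sum_right insert.hyps)
  define \<mu> where "\<mu> = (if form e1 e1 = 0 then 0 else form p1 e1 / form e1 e1)"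
  define r where "r k = p1 k - Polynomial.smult \<mu> (e1 k)" for k
  have rB: "form r (f b) = 0" if "b \<in> B" for b
    unfolding r_def using p1 e1 that by (simp add: form_diff_left form_smult_left)
  have "form r e1 = 0"
  proof (cases "form e1 e1 = 0")
    case True
    then have "form r e1 = form r (\<lambda>k. 0)" by (intro form_cong form_definite) auto
    then show ?thesis by (simp add: form_zero_right)
  next
    case False
    then show ?thesis unfolding r_def by (simp add: form_diff_left form_smult_left \<mu>_def)
  qed
  then have re: "form r (f e) = 0" using to_e1[OF rB] by simp
  define c'' where "c'' a = (if a = e then \<mu> else c a - \<mu> * c' a)" for a
  have "r k = p k - (\<Sum>a\<in>insert e B. Polynomial.smult (c'' a) (f a k))" for k
  proof -
    have "(\<Sum>a\<in>B. Polynomial.smult (c'' a) (f a k))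
      = (\<Sum>a\<in>B. Polynomial.smult (c a) (f a k)) - Polynomial.smult \<mu> (\<Sum>a\<in>B. Polynomial.smult (c' a) (f a k))"
      unfolding smult_sum2 sum_subtractf[symmetric] c''_def using insert.hyps
      by (intro sum.cong) (auto simp: smult_diff_left)
    then show ?thesis using insert.hyps
      by (simp add: r_def p1_def e1_def c''_def smult_diff_right)
  qed
  then have r_eq: "r = (\<lambda>k. p k - (\<Sum>a\<in>insert e B. Polynomial.smult (c'' a) (f a k)))" by (rule ext)
  have "\<forall>b\<in>insert e B. form r (f b) = 0" using rB re by blast
  then show ?case unfolding r_eq by (rule exI[of _ c''])
qed

text \<open>
  Row \<open>i\<close> of the \<open>n\<close>-th monic orthogonal polynomial: \<open>x\<^sup>n\<close> times the \<open>i\<close>-th unit vector, minus its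
  projection to the rows of lower degree.\<close>

lemma monic_row_exists:
  "\<exists>p. (\<forall>k<d. coeff (p k) n = (if k = i then 1 else 0)) \<and> deg_less (Suc n) p \<and>
     (\<forall>q. deg_less n q \<longrightarrow> form p q = 0)"
proof -
  define B where "B = {..<n} \<times> {..<d}"
  define f where "f b k = (if k = snd b then monom 1 (fst b) else (0 :: complex poly))" for b :: "nat \<times> nat" and k :: nat
  define m where "m k = (if k = i then monom 1 n else (0 :: complex poly))" for k
  have B: "finite B" by (simp add: B_def)
  obtain c where c: "\<And>b. b \<in> B \<Longrightarrow> form (\<lambda>k. m k - (\<Sum>a\<in>B. Polynomial.smult (c a) (f a k))) (f b) = 0"
    using projection_exists[OF B, of m f] by blast
  define p where "p k = m k - (\<Sum>a\<in>B. Polynomial.smult (c a) (f a k))" for k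
  have low: "coeff (\<Sum>a\<in>B. Polynomial.smult (c a) (f a k)) t = 0" if "t \<ge> n" for k t
    unfolding coeff_sum
  proof (intro sum.neutral ballI)
    fix a assume "a \<in> B"
    then have "fst a < n" by (auto simp: B_def)
    then show "coeff (Polynomial.smult (c a) (f a k)) t = 0" using that by (simp add: f_def)
  qed
  have "form p q = 0" if q: "deg_less n q" for q
  proof -
    have "q k = (\<Sum>b\<in>B. Polynomial.smult (coeff (q (snd b)) (fst b)) (f b k))" if "k < d" for k
    proof (rule poly_eqI)
      fix u
      have "coeff (\<Sum>b\<in>B. Polynomial.smult (coeff (q (snd b)) (fst b)) (f b k)) u
        = (\<Sum>t<n. \<Sum>s<d. if k = s then (if t = u then coeff (q s) t else 0) else 0)"
        unfolding coeff_sum B_def sum.cartesian_product by (intro sum.cong refl) (simp add: f_def split: prod.splits)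
      also have "\<dots> = (if u < n then coeff (q k) u else 0)"
        using that by (simp add: sum.delta)
      also have "\<dots> = coeff (q k) u"
        using q that by (auto simp: row_degree_less_def)
      finally show "coeff (q k) u = coeff (\<Sum>b\<in>B. Polynomial.smult (coeff (q (snd b)) (fst b)) (f b k)) u" ..
    qed
    then have "form p q = form p (\<lambda>k. \<Sum>b\<in>B. Polynomial.smult (coeff (q (snd b)) (fst b)) (f b k))"
      by (intro form_cong) auto
    also have "\<dots> = 0"
      unfolding form_sum_right[OF B] using c unfolding p_def[abs_def] by (intro sum.neutral) simp
    finally show ?thesis .
  qed
  moreover have "\<forall>k<d. coeff (p k) n = (if k = i then 1 else 0)" "deg_less (Suc n) p"
    using low by (auto simp: p_def m_def row_degree_less_def)
  ultimately show ?thesis by blast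
qed

lemma monic_OPS_rows:
  assumes "is_monic_OPS d W P" "i < d"
  shows "P n \<in> carrier_mat d d" "deg_less (Suc n) (\<lambda>k. P n $$ (i, k))"
    "k < d \<Longrightarrow> coeff (P n $$ (i, k)) n = (if k = i then 1 else 0)"
    "j < d \<Longrightarrow> n \<noteq> m \<Longrightarrow> form (\<lambda>k. P n $$ (i, k)) (\<lambda>k. P m $$ (j, k)) = 0"
proof -
  have M: "monic_of_degree d n (P n)" for n using assms by (auto simp: is_monic_OPS_def)
  then show Pn: "P n \<in> carrier_mat d d" for n by (auto simp: monic_of_degree_def)
  show "deg_less (Suc n) (\<lambda>k. P n $$ (i, k))"
    unfolding row_degree_less_def
  proof (intro allI impI)
    fix k t assume "k < d" "t \<ge> Suc n"
    moreover have "degree (P n $$ (i, k)) \<le> n" if "k < d" for k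
      using M[of n] assms(2) that by (auto simp: monic_of_degree_def degree_le_def)
    ultimately show "coeff (P n $$ (i, k)) t = 0" by (intro coeff_eq_0) (metis Suc_le_lessD le_less_trans)
  qed
  show "coeff (P n $$ (i, k)) n = (if k = i then 1 else 0)" if "k < d"
  proof -
    have "map_mat (\<lambda>p. coeff p n) (P n) $$ (i, k) = 1\<^sub>m d $$ (i, k)"
      using M[of n] by (simp add: monic_of_degree_def)
    then show ?thesis using that assms(2) Pn[of n] by auto
  qed
  show "form (\<lambda>k. P n $$ (i, k)) (\<lambda>k. P m $$ (j, k)) = 0" if "j < d" "n \<noteq> m"
    using assms that matrix_inner_entry[where W = W, OF Pn[of n] Pn[of m] W_carrier assms(2) that(1)]
    by (simp add: is_monic_OPS_def)
qed

text \<open>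
  Orthogonality to the other members of the sequence extends to all rows of lower degree, since the rows
  of \<open>P 0, \<dots>, P (n - 1)\<close> span them: subtract the combination with the same leading coefficients and
  descend.\<close>

lemma monic_OPS_orthogonal:
  assumes P: "is_monic_OPS d W P" and i: "i < d" and q: "deg_less n q"
  shows "form (\<lambda>k. P n $$ (i, k)) q = 0"
proof -
  have "form (\<lambda>k. P n $$ (i, k)) q = 0" if "m \<le> n" "deg_less m q" for m
    using that
  proof (induction m arbitrary: q)
    case 0
    then have "form (\<lambda>k. P n $$ (i, k)) q = form (\<lambda>k. P n $$ (i, k)) (\<lambda>k. 0)"
      by (intro form_cong) (auto simp: row_degree_less_def poly_eq_iff)
    then show ?case by (simp add: form_zero_right)
  next
    case (Suc m)
    define s where "s k = (\<Sum>j<d. Polynomial.smult (coeff (q j) m) (P m $$ (j, k)))" for k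
    have "deg_less m (\<lambda>k. q k - s k)"
      unfolding row_degree_less_def
    proof (intro allI impI)
      fix k t assume k: "k < d" and t: "t \<ge> m"
      show "coeff (q k - s k) t = 0"
      proof (cases "t = m")
        case True
        have "coeff (s k) m = (\<Sum>j<d. if k = j then coeff (q j) m else 0)"
          unfolding s_def coeff_sum using monic_OPS_rows(3)[OF P _ k] by (intro sum.cong) auto
        then show ?thesis using k True by simp
      next
        case False
        then have "t \<ge> Suc m" using t by simp
        then have "coeff (q k) t = 0" and "\<And>j. j < d \<Longrightarrow> coeff (P m $$ (j, k)) t = 0"
          using Suc.prems monic_OPS_rows(2)[OF P, of _ m] k by (auto simp: row_degree_less_def)
        then show ?thesis by (simp add: s_def coeff_sum)
      qed
    qed
    then have "form (\<lambda>k. P n $$ (i, k)) (\<lambda>k. q k - s k) = 0" using Suc by auto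
    moreover have "form (\<lambda>k. P n $$ (i, k)) s = 0"
      unfolding s_def using monic_OPS_rows(4)[OF P i, of _ n m] Suc.prems by (simp add: form_sum_right)
    ultimately show ?case by (simp add: form_diff_right)
  qed
  then show ?thesis using q by blast
qed

lemma orthogonal_to_lower_degree_unique:
  assumes "deg_less n r" "\<And>q. deg_less n q \<Longrightarrow> form r q = 0" "k < d"
  shows "r k = 0"
  using form_definite assms by blast

lemma monic_OPS_exists: "\<exists>P. is_monic_OPS d W P"
proof -
  define p where "p n i = (SOME p. (\<forall>k<d. coeff (p k) n = (if k = i then 1 else 0)) \<and>
     deg_less (Suc n) p \<and> (\<forall>q. deg_less n q \<longrightarrow> form p q = 0))" for n i :: nat
  have p: "\<And>n i k. k < d \<Longrightarrow> coeff (p n i k) n = (if k = i then 1 else 0)"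
    "\<And>n i. deg_less (Suc n) (p n i)" "\<And>n i q. deg_less n q \<Longrightarrow> form (p n i) q = 0"
    using someI_ex[OF monic_row_exists] unfolding p_def[symmetric] by blast+
  define P where "P n = mat d d (\<lambda>(i, k). p n i k)" for n
  have Pc: "P n \<in> carrier_mat d d" for n by (simp add: P_def)
  have lower: "form (p n i) (p m j) = 0" if "m < n" for n m i j
    using p(2)[of m j] that by (intro p(3)) (auto simp: row_degree_less_def)
  have orth: "form (p n i) (p m j) = 0" if "n \<noteq> m" for n m i j
  proof (cases "m < n")
    case False
    then have "form (p m j) (p n i) = 0" using that by (intro lower) auto
    then show ?thesis unfolding form_conj[of "p n i" "p m j"] by simp
  qed (rule lower)
  have "is_monic_OPS d W P"
    unfolding is_monic_OPS_def monic_of_degree_def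
  proof (intro conjI allI impI)
    fix n
    show "P n \<in> carrier_mat d d" by (rule Pc)
    show "degree_le n (P n)"
      using p(2)[of n] by (auto simp: degree_le_def P_def row_degree_less_def intro!: degree_le)
    show "map_mat (\<lambda>p. coeff p n) (P n) = 1\<^sub>m d"
      using p(1) by (intro eq_matI) (auto simp: P_def)
  next
    fix n m :: nat assume nm: "n \<noteq> m"
    show "matrix_inner d W (P n) (P m) = 0\<^sub>m d d"
    proof (rule eq_matI)
      fix i j assume ij: "i < dim_row (0\<^sub>m d d :: complex mat)" "j < dim_col (0\<^sub>m d d :: complex mat)"
      have "form (\<lambda>k. P n $$ (i, k)) (\<lambda>k. P m $$ (j, k)) = form (p n i) (p m j)"
        using ij by (intro form_cong) (auto simp: P_def)
      then show "matrix_inner d W (P n) (P m) $$ (i, j) = 0\<^sub>m d d $$ (i, j)"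
        using ij orth[OF nm] matrix_inner_entry[where W = W, OF Pc Pc W_carrier] by simp
    qed (simp_all add: matrix_inner_def)
  qed
  then show ?thesis by blast
qed

lemma monic_OPS_unique:
  assumes P: "is_monic_OPS d W P" and Q: "is_monic_OPS d W Q"
  shows "P = Q"
proof
  fix n
  show "P n = Q n"
  proof (cases "d = 0")
    case True
    have "P n \<in> carrier_mat d d" "Q n \<in> carrier_mat d d"
      using P Q by (auto simp: is_monic_OPS_def monic_of_degree_def)
    then show ?thesis using True by (intro eq_matI) auto
  next
    case False
    then have c: "P n \<in> carrier_mat d d" "Q n \<in> carrier_mat d d"
      using monic_OPS_rows(1)[OF P] monic_OPS_rows(1)[OF Q] by auto
    have "P n $$ (i, k) = Q n $$ (i, k)" if i: "i < d" and k: "k < d" for i k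
    proof -
      define r where "r k = P n $$ (i, k) - Q n $$ (i, k)" for k
      have "deg_less n r"
        unfolding row_degree_less_def
      proof (intro allI impI)
        fix k t assume k: "k < d" and t: "t \<ge> n"
        show "coeff (r k) t = 0"
        proof (cases "t = n")
          case True
          then show ?thesis
            using monic_OPS_rows(3)[OF P i k] monic_OPS_rows(3)[OF Q i k] by (simp add: r_def)
        next
          case False
          then have "t \<ge> Suc n" using t by simp
          then have "coeff (P n $$ (i, k)) t = 0" "coeff (Q n $$ (i, k)) t = 0"
            using monic_OPS_rows(2)[OF P i, of n] monic_OPS_rows(2)[OF Q i, of n] k
            unfolding row_degree_less_def by blast+
          then show ?thesis by (simp add: r_def)
        qed
      qed
      moreover have "form r q = 0" if "deg_less n q" for q
        unfolding r_def using monic_OPS_orthogonal[OF P i that] monic_OPS_orthogonal[OF Q i that]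
        by (simp add: form_diff_left)
      ultimately have "r k = 0" using orthogonal_to_lower_degree_unique k by blast
      then show ?thesis by (simp add: r_def)
    qed
    then show ?thesis using c by (intro eq_matI) auto
  qed
qed

lemma is_monic_OPS_monic_OPS: "is_monic_OPS d W (monic_OPS d W)"
proof -
  obtain P where P: "is_monic_OPS d W P" using monic_OPS_exists by blast
  have "\<exists>!P. is_monic_OPS d W P" by (rule ex1I[of _ P]) (use P monic_OPS_unique in blast)+
  then show ?thesis unfolding monic_OPS_def by (rule theI')
qed

text \<open>
  The difference of the two sides has degree less than \<open>n\<close> and, by symmetry of \<open>T\<close>, is orthogonal to
  every row of degree less than \<open>n\<close>, itself included.\<close>

lemma eigenrow_of_symmetric_operator:
  assumes P: "is_monic_OPS d W P" and i: "i < d"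
    and symmetric: "\<And>p q. form (T p) q = form p (T q)"
    and degree: "\<And>q. deg_less n q \<Longrightarrow> deg_less n (T q)"
    and leading: "deg_less n (\<lambda>k. T (\<lambda>k. P n $$ (i, k)) k - Polynomial.smult \<mu> (P n $$ (i, k)))"
    and k: "k < d"
  shows "T (\<lambda>k. P n $$ (i, k)) k = Polynomial.smult \<mu> (P n $$ (i, k))"
proof -
  have "form (\<lambda>k. T (\<lambda>k. P n $$ (i, k)) k - Polynomial.smult \<mu> (P n $$ (i, k))) q = 0" if "deg_less n q" for q
    using monic_OPS_orthogonal[OF P i that] monic_OPS_orthogonal[OF P i degree[OF that]]
    by (simp add: form_diff_left form_smult_left symmetric)
  from orthogonal_to_lower_degree_unique[OF leading this k] show ?thesis by simp
qed

end

section \<open>Symmetry of second order operators by integration by parts\<close>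

definition second_order_row ::
  "nat \<Rightarrow> (nat \<Rightarrow> nat \<Rightarrow> complex poly) \<Rightarrow> (nat \<Rightarrow> real) \<Rightarrow> (nat \<Rightarrow> complex poly) \<Rightarrow> nat \<Rightarrow> complex poly" where
  "second_order_row d B1 b0 p c = [:-1, 0, 1:] * pderiv (pderiv (p c))
     + (\<Sum>k<d. pderiv (p k) * B1 k c) + Polynomial.smult (of_real (b0 c)) (p c)"

lemma has_vector_derivative_poly_of_real:
  "((\<lambda>x. poly p (complex_of_real x)) has_vector_derivative poly (pderiv p) (of_real x)) (at x)"
  by (intro has_vector_derivative_real_field poly_DERIV)

lemma has_vector_derivative_cnj_poly_of_real:
  "((\<lambda>x. cnj (poly p (complex_of_real x))) has_vector_derivative cnj (poly (pderiv p) (of_real x))) (at x)"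
  using bounded_linear.has_vector_derivative[OF bounded_linear_cnj has_vector_derivative_poly_of_real] .

text \<open>
  The two derivative hypotheses are the entries of \<open>((x\<^sup>2 - 1) W)' = (B\<^sub>1 W + W B\<^sub>1\<^sup>T) / 2\<close> and
  \<open>Z' = B\<^sub>0 W - W B\<^sub>0\<close> with \<open>Z = (B\<^sub>1 W - W B\<^sub>1\<^sup>T) / 2\<close>.  They say exactly that the difference of the two
  integrands is the derivative of
  \<open>(x\<^sup>2 - 1) (P' W Q\<^sup>* - P W Q'\<^sup>* ) + P Z Q\<^sup>*\<close>, which vanishes at both ends together with \<open>W\<close>.\<close>

lemma second_order_symmetric:
  fixes d :: nat and w b :: "nat \<Rightarrow> nat \<Rightarrow> real \<Rightarrow> real" and b0 :: "nat \<Rightarrow> real"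
  defines "bw \<equiv> \<lambda>k l x. \<Sum>r<d. b k r x * w r l x"
  assumes W: "\<And>k l x. k < d \<Longrightarrow> l < d \<Longrightarrow> x \<in> {-1..1} \<Longrightarrow> W x $$ (k, l) = complex_of_real (w k l x)"
    and B1: "\<And>k l x. k < d \<Longrightarrow> l < d \<Longrightarrow> poly (B1 k l) (complex_of_real x) = of_real (b k l x)"
    and w_cont: "\<And>k l. k < d \<Longrightarrow> l < d \<Longrightarrow> continuous_on {-1..1} (w k l)"
    and b_cont: "\<And>k l. k < d \<Longrightarrow> l < d \<Longrightarrow> continuous_on {-1..1} (b k l)"
    and w_sym: "\<And>k l x. k < d \<Longrightarrow> l < d \<Longrightarrow> w k l x = w l k x"
    and w_ends: "\<And>k l. k < d \<Longrightarrow> l < d \<Longrightarrow> w k l 1 = 0" "\<And>k l. k < d \<Longrightarrow> l < d \<Longrightarrow> w k l (-1) = 0"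
    and first: "\<And>k l x. k < d \<Longrightarrow> l < d \<Longrightarrow> x \<in> {-1<..<1} \<Longrightarrow>
      ((\<lambda>x. (x\<^sup>2 - 1) * w k l x) has_real_derivative (bw k l x + bw l k x) / 2) (at x)"
    and second: "\<And>k l x. k < d \<Longrightarrow> l < d \<Longrightarrow> x \<in> {-1<..<1} \<Longrightarrow>
      ((\<lambda>x. (bw k l x - bw l k x) / 2) has_real_derivative (b0 k - b0 l) * w k l x) (at x)"
  shows "row_form d W (second_order_row d B1 b0 p) q = row_form d W p (second_order_row d B1 b0 q)"
proof -
  let ?T = "second_order_row d B1 b0"
  define P where "P k x = poly (p k) (complex_of_real x)" for k x
  define P' where "P' k x = poly (pderiv (p k)) (complex_of_real x)" for k x
  define P'' where "P'' k x = poly (pderiv (pderiv (p k))) (complex_of_real x)" for k x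
  define Q where "Q k x = cnj (poly (q k) (complex_of_real x))" for k x
  define Q' where "Q' k x = cnj (poly (pderiv (q k)) (complex_of_real x))" for k x
  define Q'' where "Q'' k x = cnj (poly (pderiv (pderiv (q k))) (complex_of_real x))" for k x
  note defs = P_def P'_def P''_def Q_def Q'_def Q''_def
  define \<rho> where "\<rho> k l x = complex_of_real ((x\<^sup>2 - 1) * w k l x)" for k l x
  define z where "z k l x = complex_of_real ((bw k l x - bw l k x) / 2)" for k l x
  define \<Phi> where "\<Phi> x = (\<Sum>k<d. \<Sum>l<d. \<rho> k l x * (P' k x * Q l x - P k x * Q' l x) + z k l x * (P k x * Q l x))" for x
  define \<phi> where "\<phi> x = (\<Sum>k<d. \<Sum>l<d. P' k x * bw k l x * Q l x - P k x * bw l k x * Q' l x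
      + \<rho> k l x * (P'' k x * Q l x - P k x * Q'' l x) + of_real ((b0 k - b0 l) * w k l x) * (P k x * Q l x))" for x
  define f where "f x = (\<Sum>k<d. \<Sum>l<d. poly (?T p k) (of_real x) * complex_of_real (w k l x) * cnj (poly (q l) (of_real x)))" for x
  define g where "g x = (\<Sum>k<d. \<Sum>l<d. poly (p k) (of_real x) * complex_of_real (w k l x) * cnj (poly (?T q l) (of_real x)))" for x
  have bw_cont: "continuous_on {-1..1} (bw k l)" if "k < d" "l < d" for k l
    unfolding bw_def using that by (intro continuous_intros w_cont b_cont) auto
  have "((\<lambda>x. \<Phi> x) has_vector_derivative \<phi> x) (at x)" if x: "x \<in> {-1<..<1}" for x
    unfolding \<Phi>_def \<phi>_def
  proof (intro has_vector_derivative_sum)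
    fix k l assume "k \<in> {..<d}" "l \<in> {..<d}"
    then have kl: "k < d" "l < d" by auto
    have d: "(P k has_vector_derivative P' k x) (at x)" "(P' k has_vector_derivative P'' k x) (at x)"
      "(Q l has_vector_derivative Q' l x) (at x)" "(Q' l has_vector_derivative Q'' l x) (at x)"
      unfolding defs[abs_def] by (rule has_vector_derivative_poly_of_real has_vector_derivative_cnj_poly_of_real)+
    have r: "(\<rho> k l has_vector_derivative of_real ((bw k l x + bw l k x) / 2)) (at x)"
      unfolding \<rho>_def[abs_def] by (intro has_vector_derivative_of_real first kl x)
    have z: "(z k l has_vector_derivative of_real ((b0 k - b0 l) * w k l x)) (at x)"
      unfolding z_def[abs_def] by (intro has_vector_derivative_of_real second kl x)
    have "((\<lambda>x. \<rho> k l x * (P' k x * Q l x - P k x * Q' l x) + z k l x * (P k x * Q l x)) has_vector_derivative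
       (\<rho> k l x * ((P' k x * Q' l x + P'' k x * Q l x) - (P k x * Q'' l x + P' k x * Q' l x))
         + of_real ((bw k l x + bw l k x) / 2) * (P' k x * Q l x - P k x * Q' l x))
       + (z k l x * (P k x * Q' l x + P' k x * Q l x) + of_real ((b0 k - b0 l) * w k l x) * (P k x * Q l x))) (at x)"
      by (intro has_vector_derivative_add has_vector_derivative_mult has_vector_derivative_diff d r z)
    moreover have "(\<rho> k l x * ((P' k x * Q' l x + P'' k x * Q l x) - (P k x * Q'' l x + P' k x * Q' l x))
         + of_real ((bw k l x + bw l k x) / 2) * (P' k x * Q l x - P k x * Q' l x))
       + (z k l x * (P k x * Q' l x + P' k x * Q l x) + of_real ((b0 k - b0 l) * w k l x) * (P k x * Q l x))
      = P' k x * bw k l x * Q l x - P k x * bw l k x * Q' l x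
      + \<rho> k l x * (P'' k x * Q l x - P k x * Q'' l x) + of_real ((b0 k - b0 l) * w k l x) * (P k x * Q l x)"
      unfolding z_def by (simp add: field_simps)
    ultimately show "((\<lambda>x. \<rho> k l x * (P' k x * Q l x - P k x * Q' l x) + z k l x * (P k x * Q l x)) has_vector_derivative
       P' k x * bw k l x * Q l x - P k x * bw l k x * Q' l x
      + \<rho> k l x * (P'' k x * Q l x - P k x * Q'' l x) + of_real ((b0 k - b0 l) * w k l x) * (P k x * Q l x)) (at x)"
      by (simp only:)
  qed
  moreover have "continuous_on {-1..1} \<Phi>"
    unfolding \<Phi>_def defs \<rho>_def z_def by (intro continuous_intros w_cont bw_cont) auto
  ultimately have "(\<phi> has_integral (\<Phi> 1 - \<Phi> (-1))) {-1..1}"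
    by (intro fundamental_theorem_of_calculus_interior) auto
  moreover have "\<Phi> 1 = 0" "\<Phi> (-1) = 0"
    unfolding \<Phi>_def \<rho>_def z_def bw_def using w_ends by (simp_all add: sum.neutral)
  ultimately have \<phi>_int: "(\<phi> has_integral 0) {-1..1}" by simp
  have Tp: "poly (?T p k) (of_real x) = of_real (x\<^sup>2 - 1) * P'' k x + (\<Sum>r<d. P' r x * of_real (b r k x)) + of_real (b0 k) * P k x"
    if "k < d" for k x
    using that by (simp add: second_order_row_def poly_sum B1 defs power2_eq_square algebra_simps)
  have Tq: "cnj (poly (?T q k) (of_real x)) = of_real (x\<^sup>2 - 1) * Q'' k x + (\<Sum>r<d. Q' r x * of_real (b r k x)) + of_real (b0 k) * Q k x"
    if "k < d" for k x
    using that by (simp add: second_order_row_def poly_sum B1 defs power2_eq_square algebra_simps)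
  have "\<phi> x = f x - g x" for x
  proof -
    have s1: "(\<Sum>k<d. \<Sum>l<d. P' k x * of_real (bw k l x) * Q l x)
        = (\<Sum>k<d. \<Sum>l<d. (\<Sum>r<d. P' r x * of_real (b r k x)) * of_real (w k l x) * Q l x)"
    proof -
      have "(\<Sum>k<d. \<Sum>l<d. P' k x * of_real (bw k l x) * Q l x)
        = (\<Sum>k<d. \<Sum>l<d. \<Sum>r<d. P' k x * of_real (b k r x) * of_real (w r l x) * Q l x)"
        by (simp add: bw_def sum_distrib_left sum_distrib_right mult_ac)
      also have "\<dots> = (\<Sum>l<d. \<Sum>k<d. \<Sum>r<d. P' k x * of_real (b k r x) * of_real (w r l x) * Q l x)"
        by (rule sum.swap)
      also have "\<dots> = (\<Sum>l<d. \<Sum>r<d. \<Sum>k<d. P' k x * of_real (b k r x) * of_real (w r l x) * Q l x)"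
        by (intro sum.cong refl sum.swap)
      also have "\<dots> = (\<Sum>r<d. \<Sum>l<d. \<Sum>k<d. P' k x * of_real (b k r x) * of_real (w r l x) * Q l x)"
        by (rule sum.swap)
      finally show ?thesis by (simp add: sum_distrib_right)
    qed
    have s2: "(\<Sum>k<d. \<Sum>l<d. P k x * of_real (bw l k x) * Q' l x)
        = (\<Sum>k<d. \<Sum>l<d. P k x * of_real (w k l x) * (\<Sum>r<d. Q' r x * of_real (b r l x)))"
    proof -
      have "(\<Sum>k<d. \<Sum>l<d. P k x * of_real (bw l k x) * Q' l x)
        = (\<Sum>k<d. \<Sum>l<d. \<Sum>r<d. P k x * of_real (w k r x) * (Q' l x * of_real (b l r x)))"
        unfolding bw_def of_real_sum sum_distrib_left sum_distrib_right
        by (intro sum.cong refl) (simp add: mult_ac w_sym[of _ k for k])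
      also have "\<dots> = (\<Sum>k<d. \<Sum>r<d. \<Sum>l<d. P k x * of_real (w k r x) * (Q' l x * of_real (b l r x)))"
        by (intro sum.cong refl sum.swap)
      finally show ?thesis by (simp add: sum_distrib_left)
    qed
    have "f x - g x = (\<Sum>k<d. \<Sum>l<d. 
       (of_real (x\<^sup>2 - 1) * P'' k x + (\<Sum>r<d. P' r x * of_real (b r k x)) + of_real (b0 k) * P k x) * of_real (w k l x) * Q l x
       - P k x * of_real (w k l x) * (of_real (x\<^sup>2 - 1) * Q'' l x + (\<Sum>r<d. Q' r x * of_real (b r l x)) + of_real (b0 l) * Q l x))"
      unfolding f_def g_def sum_subtractf[symmetric] using Tp Tq by (intro sum.cong refl) (simp add: P_def Q_def)
    also have "\<dots> = (\<Sum>k<d. \<Sum>l<d. 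
       ((\<Sum>r<d. P' r x * of_real (b r k x)) * of_real (w k l x) * Q l x
       - P k x * of_real (w k l x) * (\<Sum>r<d. Q' r x * of_real (b r l x)))
       + (\<rho> k l x * (P'' k x * Q l x - P k x * Q'' l x) + of_real ((b0 k - b0 l) * w k l x) * (P k x * Q l x)))"
      by (intro sum.cong refl) (simp add: \<rho>_def algebra_simps)
    also have "\<dots> = \<phi> x"
      unfolding \<phi>_def sum.distrib sum_subtractf s1 s2 add.assoc ..
    finally show ?thesis ..
  qed
  then have \<phi>_eq: "\<phi> = (\<lambda>x. f x - g x)" by (rule ext)
  have "f integrable_on {-1..1}" "g integrable_on {-1..1}"
    unfolding f_def g_def by (intro integrable_continuous_real continuous_intros w_cont; auto)+
  then have "integral {-1..1} f = integral {-1..1} g"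
    using integral_diff[of f "{-1..1}" g] integral_unique[OF \<phi>_int] unfolding \<phi>_eq by simp
  moreover have "row_form d W (?T p) q = integral {-1..1} f"
    unfolding row_form_def f_def using W by (intro integral_cong sum.cong) auto
  moreover have "row_form d W p (?T q) = integral {-1..1} g"
    unfolding row_form_def g_def using W by (intro integral_cong sum.cong) auto
  ultimately show ?thesis by simp
qed

section \<open>The operator and its eigenvalues\<close>

lemma weight_trig_ends: "weight_trig N k l 0 = 0" "weight_trig N k l pi = 0"
proof -
  have "sin ((real s - 2 * real a) * pi) = 0" for s a
  proof -
    have "(real s - 2 * real a) * pi = pi * of_int (int s - 2 * int a)" by simp
    then show ?thesis by (simp only: sin_npi_int)
  qed
  then show "weight_trig N k l 0 = 0" "weight_trig N k l pi = 0"
    by (simp_all only: weight_trig_def sine_sum_def mult_zero_right sin_zero sum.neutral_const div_0)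
qed

lemma continuous_on_weight_trig_arccos:
  "continuous_on {-1..1} (\<lambda>x. weight_trig N k l (arccos x))"
proof -
  have "continuous_on UNIV (weight_trig N k l)"
    unfolding weight_trig_def[abs_def] sine_sum_def divide_inverse by (intro continuous_intros)
  then show ?thesis
    using continuous_on_compose[OF continuous_on_arccos', of "weight_trig N k l"] continuous_on_subset
    by (fastforce simp: o_def)
qed

lemma positive_weight_weight: "positive_weight (N + 1) (weight N)"
proof
  show "weight N x \<in> carrier_mat (N + 1) (N + 1)" for x by (simp add: weight_def)
next
  fix k l assume "k < N + 1" "l < N + 1"
  then have kl: "k \<le> N" "l \<le> N" by auto
  have "continuous_on {-1..1} (\<lambda>x. complex_of_real (weight_trig N k l (arccos x)))"
    by (intro continuous_intros continuous_on_weight_trig_arccos)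
  then show "continuous_on {-1..1} (\<lambda>x. weight N x $$ (k, l))"
    by (rule continuous_on_eq) (simp add: weight_eq_weight_trig[OF kl])
  fix x :: real assume "x \<in> {-1..1}"
  then show "weight N x $$ (l, k) = cnj (weight N x $$ (k, l))"
    using kl by (simp add: weight_eq_weight_trig weight_trig_sym[of N l])
next
  fix x :: real and v :: "nat \<Rightarrow> complex"
  assume x: "x \<in> {-1<..<1}" and v: "\<exists>k<N + 1. v k \<noteq> 0"
  define c where "c k = v k / of_nat (N choose k)" for k
  have sin: "sin (arccos x) > 0" using x arccos_lt_bounded[of x] by (intro sin_gt_zero) auto
  have "\<exists>k<N + 1. c k \<noteq> 0" using v by (auto simp: c_def)
  from sine_sum_positive[OF sin this]
  have "Re (\<Sum>k<N + 1. \<Sum>l<N + 1. c k * of_real (sine_sum N (k + l + 1) (l + 1) (arccos x)) * cnj (c l)) > 0" .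
  also have "(\<Sum>k<N + 1. \<Sum>l<N + 1. c k * of_real (sine_sum N (k + l + 1) (l + 1) (arccos x)) * cnj (c l))
    = (\<Sum>k<N + 1. \<Sum>l<N + 1. v k * weight N x $$ (k, l) * cnj (v l))"
    using x by (intro sum.cong refl) (simp add: weight_eq_weight_trig weight_trig_def c_def)
  finally show "Re (\<Sum>k<N + 1. \<Sum>l<N + 1. v k * weight N x $$ (k, l) * cnj (v l)) > 0" .
qed

lemma poly_coeff_B1:
  assumes "i < N + 1" "j < N + 1"
  shows "poly (coeff_B1 N $$ (i, j)) (complex_of_real x) = of_real (B1_entry N i j x)"
  using assms by (simp add: coeff_B1_def B1_entry_def) (auto simp: algebra_simps)

text \<open>
  The substitution \<open>x = cos \<theta>\<close>.  The factor \<open>x\<^sup>2 - 1 = - (sin \<theta>)\<^sup>2\<close> absorbs the singular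
  \<open>d\<theta>/dx = - 1 / sin \<theta>\<close>.\<close>

lemma symmetry_equations:
  assumes "N > 0" "k \<le> N" "l \<le> N" "x \<in> {-1<..<1}"
  defines "w \<equiv> \<lambda>k l x. weight_trig N k l (arccos x)"
  defines "bw \<equiv> \<lambda>k l x. \<Sum>r<N + 1. B1_entry N k r x * w r l x"
  shows "((\<lambda>x. (x\<^sup>2 - 1) * w k l x) has_real_derivative (bw k l x + bw l k x) / 2) (at x)"
    "((\<lambda>x. (bw k l x - bw l k x) / 2) has_real_derivative (B0_entry N k - B0_entry N l) * w k l x) (at x)"
proof -
  define \<theta> where "\<theta> = arccos x"
  have x: "-1 < x" "x < 1" using assms by auto
  have cos: "cos \<theta> = x" using x by (simp add: \<theta>_def cos_arccos)
  have sin: "sin \<theta> = sqrt (1 - x\<^sup>2)" using x by (simp add: \<theta>_def sin_arccos)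
  have sin_pos: "sin \<theta> > 0" unfolding \<theta>_def using x arccos_lt_bounded[of x] by (intro sin_gt_zero) auto
  have sq: "x\<^sup>2 - 1 = - (sin \<theta> * sin \<theta>)"
    using cos sin_cos_squared_add[of \<theta>] by (simp add: power2_eq_square)
  have arccos: "(arccos has_real_derivative - (1 / sin \<theta>)) (at x)"
    using DERIV_arccos[OF x] by (simp add: sin field_simps inverse_eq_divide)
  obtain w' where w': "(weight_trig N k l has_real_derivative w') (at \<theta>)"
    and eq: "sin \<theta> * w' + 2 * cos \<theta> * weight_trig N k l \<theta> = (bw k l x + bw l k x) / 2"
    using symmetry_equations_trig(1)[OF assms(1-3), of \<theta>] unfolding bw_def w_def \<theta>_def[symmetric] cos by blast
  have "((\<lambda>x. w k l x) has_real_derivative w' * - (1 / sin \<theta>)) (at x)"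
    unfolding w_def using DERIV_chain2[OF w'[unfolded \<theta>_def] arccos[unfolded \<theta>_def]] by (simp add: \<theta>_def)
  then have "((\<lambda>x. (x\<^sup>2 - 1) * w k l x) has_real_derivative
      2 * x * w k l x + (x\<^sup>2 - 1) * (w' * - (1 / sin \<theta>))) (at x)"
    by (auto intro!: derivative_eq_intros)
  moreover have "2 * x * w k l x + (x\<^sup>2 - 1) * (w' * - (1 / sin \<theta>)) = (bw k l x + bw l k x) / 2"
    unfolding eq[symmetric] sq using sin_pos by (simp add: w_def cos \<theta>_def[symmetric] field_simps)
  ultimately show "((\<lambda>x. (x\<^sup>2 - 1) * w k l x) has_real_derivative (bw k l x + bw l k x) / 2) (at x)"
    by (simp only:)
  define g where "g \<theta> = ((\<Sum>r<N + 1. B1_entry N k r (cos \<theta>) * weight_trig N r l \<theta>)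
      - (\<Sum>r<N + 1. B1_entry N l r (cos \<theta>) * weight_trig N r k \<theta>)) / 2" for \<theta>
  have "(g has_real_derivative - sin \<theta> * ((B0_entry N k - B0_entry N l) * weight_trig N k l \<theta>)) (at \<theta>)"
    unfolding g_def[abs_def] by (rule symmetry_equations_trig(2)[OF assms(1-3)])
  from DERIV_chain2[OF this[unfolded \<theta>_def] arccos[unfolded \<theta>_def]]
  have "((\<lambda>x. g (arccos x)) has_real_derivative (B0_entry N k - B0_entry N l) * w k l x) (at x)"
    using sin_pos by (simp add: \<theta>_def[symmetric] w_def)
  then show "((\<lambda>x. (bw k l x - bw l k x) / 2) has_real_derivative (B0_entry N k - B0_entry N l) * w k l x) (at x)"
    by (rule has_field_derivative_transform_within_open[where S = "{-1<..<1}"])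
       (use x in \<open>auto simp: g_def bw_def w_def cos_arccos\<close>)
qed

definition D_row :: "nat \<Rightarrow> (nat \<Rightarrow> complex poly) \<Rightarrow> nat \<Rightarrow> complex poly" where
  "D_row N = second_order_row (N + 1) (\<lambda>i j. coeff_B1 N $$ (i, j)) (B0_entry N)"

lemma D_row_symmetric:
  assumes "N > 0"
  shows "row_form (N + 1) (weight N) (D_row N p) q = row_form (N + 1) (weight N) p (D_row N q)"
  unfolding D_row_def
proof (rule second_order_symmetric[where w = "\<lambda>k l x. weight_trig N k l (arccos x)" and b = "B1_entry N"])
  show "continuous_on {-1..1} (B1_entry N k l)" for k l
  proof -
    have "B1_entry N k l = (\<lambda>x. B1_entry N k l 0 + (B1_entry N k l 1 - B1_entry N k l 0) * x)"
      by (rule ext) (simp add: B1_entry_def)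
    moreover have "continuous_on {-1..1} (\<lambda>x. a + b * x)" for a b :: real
      by (intro continuous_intros)
    ultimately show ?thesis by metis
  qed
next
  fix k l x assume kl: "k < N + 1" "l < N + 1" and x: "x \<in> {-1<..<1::real}"
  then have le: "k \<le> N" "l \<le> N" by auto
  note eqs = symmetry_equations[OF assms le x]
  show "((\<lambda>x. (x\<^sup>2 - 1) * weight_trig N k l (arccos x)) has_real_derivative
      ((\<Sum>r<N + 1. B1_entry N k r x * weight_trig N r l (arccos x)) +
       (\<Sum>r<N + 1. B1_entry N l r x * weight_trig N r k (arccos x))) / 2) (at x)"
    by (rule eqs(1))
  show "((\<lambda>x. ((\<Sum>r<N + 1. B1_entry N k r x * weight_trig N r l (arccos x)) -
       (\<Sum>r<N + 1. B1_entry N l r x * weight_trig N r k (arccos x))) / 2) has_real_derivative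
      (B0_entry N k - B0_entry N l) * weight_trig N k l (arccos x)) (at x)"
    by (rule eqs(2))
next
  show "weight_trig N k l (arccos x) = weight_trig N l k (arccos x)" for k l x
    by (rule weight_trig_sym)
next
  fix k l x assume "k < N + 1" "l < N + 1" "x \<in> {-1..1::real}"
  then show "weight N x $$ (k, l) = complex_of_real (weight_trig N k l (arccos x))"
    by (simp add: weight_eq_weight_trig)
qed (simp_all add: poly_coeff_B1 weight_trig_ends continuous_on_weight_trig_arccos)

lemma diffop_act_op_D_entry:
  assumes "P \<in> carrier_mat (N + 1) (N + 1)" "r < N + 1" "c < N + 1"
  shows "diffop_act (N + 1) P (op_D N) $$ (r, c) = D_row N (\<lambda>k. P $$ (r, k)) c"
proof -
  have B1: "coeff_B1 N \<in> carrier_mat (N + 1) (N + 1)" by (simp add: coeff_B1_def)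
  have diag: "(A * mat_diag (N + 1) f) $$ (r, c) = A $$ (r, c) * f c"
    if "A \<in> carrier_mat (N + 1) (N + 1)" for A :: "complex poly mat" and f
  proof -
    have "(A * mat_diag (N + 1) f) $$ (r, c) = (\<Sum>k<N + 1. A $$ (r, k) * (if k = c then f c else 0))"
      using assms(3) by (subst mult_mat_entry[OF that _ assms(2,3)]) (auto simp: mat_diag_def intro!: sum.cong)
    then show ?thesis using assms(3) by (simp add: if_distrib[of "\<lambda>x. _ * x"] cong: if_cong del: sum.lessThan_Suc)
  qed
  have B0: "coeff_B0 N = mat_diag (N + 1) (\<lambda>i. [:complex_of_real (B0_entry N i):])"
    by (rule eq_matI) (auto simp: coeff_B0_def const_mat_def mat_diag_def)
  have c: "map_mat f P \<in> carrier_mat (N + 1) (N + 1)" for f :: "complex poly \<Rightarrow> complex poly"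
    using assms(1) by simp
  have sum3: "(\<Sum>i<length (op_D N). F i) = F 0 + F 1 + F 2" for F :: "nat \<Rightarrow> complex poly"
    by (simp add: op_D_def numeral_2_eq_2)
  have nth: "op_D N ! 0 = coeff_B0 N" "op_D N ! 1 = coeff_B1 N"
    "op_D N ! 2 = mat_diag (N + 1) (\<lambda>_. [: -1, 0, 1 :])"
    by (simp_all add: op_D_def)
  have "diffop_act (N + 1) P (op_D N) $$ (r, c)
     = (map_mat (pderiv ^^ 0) P * coeff_B0 N) $$ (r, c) + (map_mat (pderiv ^^ 1) P * coeff_B1 N) $$ (r, c)
       + (map_mat (pderiv ^^ 2) P * mat_diag (N + 1) (\<lambda>_. [: -1, 0, 1 :])) $$ (r, c)"
    using assms(2,3) by (simp only: diffop_act_def index_mat split sum3 nth)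
  also have "\<dots> = Polynomial.smult (of_real (B0_entry N c)) (P $$ (r, c))
       + (\<Sum>k<N + 1. pderiv (P $$ (r, k)) * coeff_B1 N $$ (k, c))
       + pderiv (pderiv (P $$ (r, c))) * [: -1, 0, 1 :]"
    unfolding B0 diag[OF c] mult_mat_entry[OF c B1 assms(2,3)]
    using assms by (simp add: numeral_2_eq_2 mult.commute)
  finally show ?thesis
    by (simp only: D_row_def second_order_row_def mult.commute[of _ "[: -1, 0, 1 :]"] add_ac)
qed

definition D_eigenvalue :: "nat \<Rightarrow> nat \<Rightarrow> nat \<Rightarrow> real" where
  "D_eigenvalue N n i = real n * (real n - 1) - real n * (2 * ell N + 3) * (real i - 2 * ell N) / ell N + B0_entry N i"

text \<open>
  On the coefficient of highest degree \<open>D\<close> acts diagonally: only \<open>x\<^sup>2\<close> in the leading term, the diagonal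
  part of \<open>B\<^sub>1\<close> and \<open>B\<^sub>0\<close> preserve the degree.\<close>

lemma coeff_D_row:
  assumes p: "row_degree_less (N + 1) (Suc t) p" and c: "c < N + 1"
  shows "coeff (D_row N p c) t = of_real (D_eigenvalue N t c) * coeff (p c) t"
proof -
  have high: "coeff (p k) u = 0" if "k < N + 1" "u > t" for k u
    using p that by (auto simp: row_degree_less_def)
  have "coeff ([: -1, 0, 1 :] * r) t = (if t \<ge> 2 then coeff r (t - 2) else 0) - coeff r t" for r :: "complex poly"
    by (cases t; cases "t - 1") (auto simp: coeff_pCons split: nat.splits)
  from this[of "pderiv (pderiv (p c))"]
  have 2: "coeff ([: -1, 0, 1 :] * pderiv (pderiv (p c))) t = of_real (real t * (real t - 1)) * coeff (p c) t"
    using high[OF c, of "Suc (Suc t)"]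
    by (cases t; cases "t - 1") (auto simp: coeff_pderiv algebra_simps)
  define \<beta> where "\<beta> = (2 * ell N + 3) * (real c - 2 * ell N) / ell N"
  have 1: "coeff (pderiv (p k) * coeff_B1 N $$ (k, c)) t
      = (if k = c then - of_real (real t * \<beta>) * coeff (p c) t else 0)" if k: "k < N + 1" for k
  proof (cases "k = c")
    case True
    have "coeff_B1 N $$ (c, c) = - [:0, of_real \<beta>:]" using c by (simp add: coeff_B1_def \<beta>_def)
    then show ?thesis
      using True by (cases t) (simp_all add: coeff_pderiv algebra_simps)
  next
    case False
    then obtain a where "coeff_B1 N $$ (k, c) = [:a:]"
      using k c by (auto simp: coeff_B1_def) (metis pCons_0_0)
    then show ?thesis using False high[OF k, of "Suc t"] by (simp add: coeff_pderiv)
  qed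
  have "coeff (D_row N p c) t = of_real (real t * (real t - 1)) * coeff (p c) t
      + (\<Sum>k<N + 1. if k = c then - of_real (real t * \<beta>) * coeff (p c) t else 0)
      + of_real (B0_entry N c) * coeff (p c) t"
    unfolding D_row_def second_order_row_def coeff_add 2 coeff_sum using 1 by simp
  also have "\<dots> = of_real (real t * (real t - 1) - real t * \<beta> + B0_entry N c) * coeff (p c) t"
    using c by (simp add: algebra_simps del: sum.lessThan_Suc)
  finally show ?thesis by (simp add: D_eigenvalue_def \<beta>_def mult.assoc)
qed

theorem theorem7p6:
  fixes N :: nat
  assumes "N > 0"
  shows "symmetric_diffop (N + 1) (weight N) (op_D N)
    \<and> op_D N \<in> diffop_algebra (N + 1) (weight N)
    \<and> (\<forall>n. diffop_act (N + 1) (monic_OPS (N + 1) (weight N) n) (op_D N)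
           = const_mat (Lambda N n) * monic_OPS (N + 1) (weight N) n)"
proof -
  interpret positive_weight "N + 1" "weight N" by (rule positive_weight_weight)
  define P where "P = monic_OPS (N + 1) (weight N)"
  have P: "is_monic_OPS (N + 1) (weight N) P" unfolding P_def by (rule is_monic_OPS_monic_OPS)
  have Pc: "P n \<in> carrier_mat (N + 1) (N + 1)" for n using monic_OPS_rows(1)[OF P, of 0] by simp
  have act_c: "diffop_act (N + 1) Q (op_D N) \<in> carrier_mat (N + 1) (N + 1)" for Q
    by (simp add: diffop_act_def)
  have "symmetric_diffop (N + 1) (weight N) (op_D N)"
    unfolding symmetric_diffop_def
  proof (intro ballI eq_matI)
    fix Q R :: "complex poly mat" and i j
    assume Q: "Q \<in> carrier_mat (N + 1) (N + 1)" and R: "R \<in> carrier_mat (N + 1) (N + 1)"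
      and "i < dim_row (matrix_inner (N + 1) (weight N) Q (diffop_act (N + 1) R (op_D N)))"
        "j < dim_col (matrix_inner (N + 1) (weight N) Q (diffop_act (N + 1) R (op_D N)))"
    then have ij: "i < N + 1" "j < N + 1" by (simp_all add: matrix_inner_def)
    have "form (\<lambda>k. diffop_act (N + 1) Q (op_D N) $$ (i, k)) (\<lambda>k. R $$ (j, k))
      = form (D_row N (\<lambda>k. Q $$ (i, k))) (\<lambda>k. R $$ (j, k))"
      by (intro form_cong diffop_act_op_D_entry Q ij refl)
    also have "\<dots> = form (\<lambda>k. Q $$ (i, k)) (D_row N (\<lambda>k. R $$ (j, k)))"
      by (rule D_row_symmetric[OF assms])
    also have "\<dots> = form (\<lambda>k. Q $$ (i, k)) (\<lambda>k. diffop_act (N + 1) R (op_D N) $$ (j, k))"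
      by (intro form_cong diffop_act_op_D_entry[symmetric] R ij refl)
    finally show "matrix_inner (N + 1) (weight N) (diffop_act (N + 1) Q (op_D N)) R $$ (i, j)
      = matrix_inner (N + 1) (weight N) Q (diffop_act (N + 1) R (op_D N)) $$ (i, j)"
      unfolding matrix_inner_entry[where W = "weight N", OF act_c R W_carrier ij]
        matrix_inner_entry[where W = "weight N", OF Q act_c W_carrier ij] .
  qed (simp_all add: matrix_inner_def)
  moreover have eigen: "diffop_act (N + 1) (P n) (op_D N) = const_mat (Lambda N n) * P n" for n
  proof (rule eq_matI)
    fix i k assume "i < dim_row (const_mat (Lambda N n) * P n)" "k < dim_col (const_mat (Lambda N n) * P n)"
    then have i: "i < N + 1" and k: "k < N + 1" using Pc[of n] by (auto simp: const_mat_def Lambda_def mat_diag_def)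
    have "D_row N (\<lambda>k. P n $$ (i, k)) k = Polynomial.smult (of_real (D_eigenvalue N n i)) (P n $$ (i, k))"
    proof (rule eigenrow_of_symmetric_operator[OF P i D_row_symmetric[OF assms] _ _ k])
      fix q assume q: "deg_less n q"
      show "deg_less n (D_row N q)"
        unfolding row_degree_less_def
      proof (intro allI impI)
        fix c t assume c: "c < N + 1" and t: "t \<ge> n"
        have "deg_less (Suc t) q" "coeff (q c) t = 0" using q c t by (auto simp: row_degree_less_def)
        then show "coeff (D_row N q c) t = 0" using coeff_D_row c by simp
      qed
    next
      show "deg_less n (\<lambda>k. D_row N (\<lambda>k. P n $$ (i, k)) k - Polynomial.smult (of_real (D_eigenvalue N n i)) (P n $$ (i, k)))"
        unfolding row_degree_less_def
      proof (intro allI impI)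
        fix c t assume c: "c < N + 1" and t: "t \<ge> n"
        have low: "deg_less (Suc t) (\<lambda>k. P n $$ (i, k))"
          using monic_OPS_rows(2)[OF P i, of n] t by (auto simp: row_degree_less_def)
        have "t = n \<and> c = i \<or> coeff (P n $$ (i, c)) t = 0"
          using monic_OPS_rows(2)[OF P i, of n] monic_OPS_rows(3)[OF P i c, of n] c t
          by (cases "t = n") (auto simp: row_degree_less_def)
        then show "coeff (D_row N (\<lambda>k. P n $$ (i, k)) c - Polynomial.smult (of_real (D_eigenvalue N n i)) (P n $$ (i, c))) t = 0"
          using coeff_D_row[OF low c] by auto
      qed
    qed
    moreover have "(const_mat (Lambda N n) * P n) $$ (i, k) = Polynomial.smult (of_real (D_eigenvalue N n i)) (P n $$ (i, k))"
    proof -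
      have L: "const_mat (Lambda N n) \<in> carrier_mat (N + 1) (N + 1)"
        by (simp add: const_mat_def Lambda_def)
      have "(const_mat (Lambda N n) * P n) $$ (i, k)
        = (\<Sum>j<N + 1. if j = i then Polynomial.smult (of_real (D_eigenvalue N n i)) (P n $$ (i, k)) else 0)"
        unfolding mult_mat_entry[OF L Pc i k]
        using i by (intro sum.cong refl) (auto simp: const_mat_def Lambda_def mat_diag_def D_eigenvalue_def)
      then show ?thesis using i by (simp del: sum.lessThan_Suc)
    qed
    ultimately show "diffop_act (N + 1) (P n) (op_D N) $$ (i, k) = (const_mat (Lambda N n) * P n) $$ (i, k)"
      unfolding diffop_act_op_D_entry[OF Pc i k] by simp
  qed (use Pc[of n] in \<open>auto simp: diffop_act_def const_mat_def Lambda_def mat_diag_def\<close>)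
  moreover have "op_D N \<in> diffop_algebra (N + 1) (weight N)"
  proof -
    have "is_diffop (N + 1) (op_D N)"
      unfolding is_diffop_def
    proof (intro allI impI)
      fix i assume "i < length (op_D N)"
      then have "i \<in> {0, 1, 2}" by (auto simp: op_D_def)
      then show "op_D N ! i \<in> carrier_mat (N + 1) (N + 1) \<and> degree_le i (op_D N ! i)"
        by (auto simp: op_D_def coeff_B0_def coeff_B1_def const_mat_def degree_le_def mat_diag_def)
    qed
    moreover have "Lambda N n \<in> carrier_mat (N + 1) (N + 1)" for n by (simp add: Lambda_def)
    ultimately show ?thesis
      using eigen unfolding diffop_algebra_def P_def by blast
  qed
  ultimately show ?thesis unfolding P_def by blast
qed

end
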